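(* Let $k\geq 2$ and $l>3$ be natural numbers such that $3\nmid l$, and such that $k$ is even or $l$ is odd. Then \[ n(k,l)= \begin{cases} \frac{2k(l-1)}{3}+2 & \text{if } l\equiv 1 \pmod 3,\\ \frac{k(2l-1)}{3}+1 & \text{if } l\equiv 2 \pmod 3 \text{ and } k\not\equiv 1 \pmod 4,\\ \frac{k(2l-1)}{3} & \text{if } l\equiv 2 \pmod 3 \text{ and } k\equiv 1 \pmod 4. \end{cases} \]
   Context: $S_n$ and $A_n$ denote the symmetric and alternating groups on $\{1,\dots,n\}$. For $2\le l\le n$, let $C_l$ be the conjugacy class of $l$-cycles in $S_n$, and let $C_l^k$ denote the set of all products of $k$ elements of $C_l$. For natural numbers $k,l\geq 2$ such that $k$ is even or $l$ is odd, $n(k,l)$ denotes the largest natural number $n$ such that $C_l^k=A_n$, that is, such that every element of $A_n$ can be written as a product of $k$ many $l$-cycles in $S_n$. *)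

theory Defs
  imports Complex_Main "HOL-Algebra.Sym_Groups"
begin

definition cycles_of_length :: "nat \<Rightarrow> nat \<Rightarrow> (nat \<Rightarrow> nat) set"
  where "cycles_of_length n l =
    {cycle_of_list cs | cs. cycle cs \<and> length cs = l \<and> set cs \<subseteq> {1..n}}"

definition cycle_products :: "nat \<Rightarrow> nat \<Rightarrow> nat \<Rightarrow> (nat \<Rightarrow> nat) set"
  where "cycle_products n l k =
    {foldr (\<circ>) ps id | ps. length ps = k \<and> set ps \<subseteq> cycles_of_length n l}"

definition covered_degrees :: "nat \<Rightarrow> nat \<Rightarrow> nat set"
  where "covered_degrees k l =
    {n. l \<le> n \<and> cycle_products n l k = carrier (alt_group n)}"

text \<open>
  \<^const>\<open>Max\<close> is only meaningful on finite nonempty sets, so statements about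
  \<open>largest_covered_degree k l\<close> should also establish that
  \<open>covered_degrees k l\<close> is finite and nonempty.
\<close>

definition largest_covered_degree :: "nat \<Rightarrow> nat \<Rightarrow> nat"
  where "largest_covered_degree k l = Max (covered_degrees k l)"

end

theory Submission
  imports Defs
begin

text \<open>
  Compositions are read from right to left. Write \<open>l = 3 * q + 1\<close> or
  \<open>l = 3 * q + 2\<close>, and let \<open>m\<close> and \<open>c\<close> be the number of moved
  points and the number of nontrivial cycles of a permutation. Everything is governed by the quantity
  \<open>m + c\<close>, compared with \<open>k * (l - 1) + 2\<close>.

  Upper bound. Join two points when one of the \<open>k\<close> given \<open>l\<close>-cycles contains both. If
  this makes a set of points connected, then the Riemann-Hurwitz inequality (the genus is nonnegative) bounds
  the number of points plus the number of cycles of the product by \<open>j * (l - 1) + 2\<close>, where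
  \<open>j\<close> counts the \<open>l\<close>-cycles inside the set (\<open>transposition_blocks_exist\<close>,
  \<open>riemann_hurwitz_blocks\<close>). If the product has only cycles shorter than \<open>l\<close>, a block
  that meets its support has \<open>j \<ge> 2\<close>, because a block with a single \<open>l\<close>-cycle
  reproduces that cycle. Transpositions are the most expensive cycles, as they contribute 3 to the left-hand
  side for only two points. A block with \<open>j\<close> of the \<open>l\<close>-cycles therefore holds at most
  \<open>(j * (l - 1) + 2) div 3\<close> transpositions. For \<open>l = 3 * q + 1\<close> this is
  \<open>q * j\<close>; for \<open>l = 3 * q + 2\<close> and \<open>j \<ge> 2\<close> it is at most
  \<open>(6 * q + 3) * j / 6\<close>, with equality for \<open>j = 2\<close> and
  \<open>j = 4\<close>. So an even permutation with too many transpositions, completed by a 3-cycle or a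
  4-cycle where parity or the degree requires it, is not a product of \<open>k\<close> \<open>l\<close>-cycles
  (\<open>not_covered\<close>).

  Lower bound. Conversely, if \<open>m + c \<le> k * (l - 1) + 2\<close>, the parity is right and
  there are at least \<open>l\<close> points, the permutation is a product of \<open>k\<close>
  \<open>l\<close>-cycles (\<open>product_of_cycles_of_lengthI\<close>). For \<open>k = 2\<close> this is
  \<open>product_of_two_cycles\<close>, where the two factors are built up point by point. For larger
  \<open>k\<close> one splits off an \<open>l\<close>-cycle that lowers \<open>m + c\<close> by exactly
  \<open>l - 1\<close> (\<open>product_of_cycles_peel\<close>). For \<open>l = 3 * q + 1\<close> every
  even permutation of the claimed degree satisfies the inequality. For \<open>l = 3 * q + 2\<close> the
  same holds for \<open>k \<le> 5\<close>; for larger \<open>k\<close> it can fail only in the presence of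
  \<open>4 * q + 2\<close> transpositions, and exactly so many of them form an optimal block for four
  \<open>l\<close>-cycles, which reduces \<open>k\<close> to \<open>k - 4\<close>.
\<close>

section \<open>Cycles written as lists\<close>

lemma cycle_of_list_append:
  "cycle_of_list (us @ z # ws) = cycle_of_list (us @ [z]) \<circ> cycle_of_list (z # ws)"
proof (induction us)
  case Nil
  show ?case by simp
next
  case (Cons u us)
  then show ?case
    by (cases us) (simp_all add: fun.map_comp o_assoc)
qed

lemma bij_cycle_of_list: "bij (cycle_of_list cs)"
  by (rule permutation_bijective[OF permutation_of_cycle])

lemma cycle_of_list_eq_iff [simp]: "cycle_of_list cs x = cycle_of_list cs y \<longleftrightarrow> x = y"
  by (rule inj_eq[OF bij_is_inj[OF bij_cycle_of_list]])

lemma cycle_of_list_in_set_iff [simp]: "cycle_of_list cs x \<in> set cs \<longleftrightarrow> x \<in> set cs"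
  by (rule permutes_in_image[OF cycle_permutes])

lemma map_cycle_of_list:
  "distinct cs \<Longrightarrow> map (cycle_of_list cs) cs = rotate1 cs"
  using cyclic_rotation[of cs 1] by simp

lemma cycle_of_list_last:
  assumes "distinct (x # xs)"
  shows "cycle_of_list (x # xs) (last (x # xs)) = x"
proof -
  have "cycle_of_list (x # xs) (last (x # xs)) = last (map (cycle_of_list (x # xs)) (x # xs))"
    by (subst last_map) simp_all
  also have "\<dots> = x"
    using map_cycle_of_list[OF assms] by simp
  finally show ?thesis .
qed

lemma cycle_of_list_rotate1:
  "distinct (x # xs) \<Longrightarrow> cycle_of_list (xs @ [x]) = cycle_of_list (x # xs)"
  using cycle_of_list_rotate_independent[of "x # xs" 1] by simp

lemma rotate_to_front:
  assumes "distinct cs" "x \<in> set cs"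
  obtains ds where "distinct (x # ds)" "set (x # ds) = set cs"
    "cycle_of_list (x # ds) = cycle_of_list cs" "length (x # ds) = length cs"
proof -
  obtain us vs where cs: "cs = us @ x # vs"
    using split_list[OF assms(2)] by blast
  have "rotate (length us) cs = (x # vs) @ us"
    unfolding cs by (rule rotate_append)
  then have "cycle_of_list (x # vs @ us) = cycle_of_list cs"
    using cycle_of_list_rotate_independent[OF assms(1), of "length us"] by simp
  then show thesis
    using that[of "vs @ us"] assms(1) by (auto simp: cs)
qed

lemma rotate_to_back:
  assumes "distinct cs" "x \<in> set cs"
  obtains ds where "distinct (ds @ [x])" "set (ds @ [x]) = set cs"
    "cycle_of_list (ds @ [x]) = cycle_of_list cs" "length (ds @ [x]) = length cs"
proof (rule rotate_to_front[OF assms])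
  fix ds
  assume "distinct (x # ds)" "set (x # ds) = set cs"
    "cycle_of_list (x # ds) = cycle_of_list cs" "length (x # ds) = length cs"
  then show thesis
    using that[of ds] cycle_of_list_rotate1[of x ds] by auto
qed

lemma cycle_of_list_conj:
  assumes "distinct cs" "bij f"
  shows "cycle_of_list (map f cs) \<circ> f = f \<circ> cycle_of_list cs"
proof -
  have "cycle_of_list (map f cs) \<circ> f = f \<circ> cycle_of_list cs \<circ> (inv' f \<circ> f)"
    unfolding conjugation_of_cycle[OF assms, symmetric] by (simp add: o_assoc)
  then show ?thesis
    using assms(2) by (simp add: bij_is_inj)
qed

text \<open>
  Two disjoint cycles are fused into one by a transposition on the left that meets each of them in its first
  entry; the next lemma is the mirror image, with the last entries and the transposition on the right. In both,
  one fuses through the two neighbouring entries of the concatenation and then moves the transposition past one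
  of the cycles by conjugation.
\<close>

lemma cycle_of_list_append_front:
  assumes "distinct (x # us)" "y \<notin> set (x # us)"
  shows "cycle_of_list (x # us @ y # vs)
    = transpose x y \<circ> cycle_of_list (x # us) \<circ> cycle_of_list (y # vs)"
proof -
  let ?l = "last (x # us)" and ?f = "cycle_of_list (x # us)"
  obtain us' where us': "x # us = us' @ [?l]"
    by (metis append_butlast_last_id list.discI)
  have "?l \<noteq> y"
    using assms(2) last_in_set[of "x # us"] by (metis list.discI)
  have "cycle_of_list (x # us @ y # vs) = cycle_of_list (us' @ ?l # y # vs)"
    using us' by (metis append.assoc append_Cons append_Nil)
  also have "\<dots> = cycle_of_list (us' @ [?l]) \<circ> cycle_of_list (?l # y # vs)"
    by (rule cycle_of_list_append)
  also have "\<dots> = ?f \<circ> cycle_of_list [?l, y] \<circ> cycle_of_list (y # vs)"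
    using us' by (simp add: o_assoc)
  also have "?f \<circ> cycle_of_list [?l, y] = cycle_of_list (map ?f [?l, y]) \<circ> ?f"
    by (rule cycle_of_list_conj[symmetric]) (use \<open>?l \<noteq> y\<close> bij_cycle_of_list in auto)
  also have "map ?f [?l, y] = [x, y]"
    using cycle_of_list_last[OF assms(1)] assms(2) by (simp add: id_outside_supp)
  finally show ?thesis
    by (simp only: cycle_of_list.simps comp_id)
qed

lemma cycle_of_list_append_back:
  assumes "distinct (us @ [x])" "distinct (vs @ [y])" "set (us @ [x]) \<inter> set (vs @ [y]) = {}"
  shows "cycle_of_list (us @ x # vs @ [y])
    = cycle_of_list (us @ [x]) \<circ> cycle_of_list (vs @ [y]) \<circ> transpose x y"
proof -
  obtain z zs where z: "vs @ [y] = z # zs"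
    by (cases "vs @ [y]") auto
  let ?g = "cycle_of_list (z # zs)"
  have gy: "?g y = z"
    using cycle_of_list_last[of z zs] assms(2) z by (metis last_snoc)
  have "x \<noteq> y"
    using assms(3) by auto
  have gx: "?g x = x"
    using assms(3) z by (intro id_outside_supp) auto
  have "cycle_of_list (us @ x # vs @ [y]) = cycle_of_list (us @ [x]) \<circ> cycle_of_list (x # z # zs)"
    using z cycle_of_list_append by metis
  also have "\<dots> = cycle_of_list (us @ [x]) \<circ> (cycle_of_list (map ?g [x, y]) \<circ> ?g)"
    using gx gy by simp
  also have "cycle_of_list (map ?g [x, y]) \<circ> ?g = ?g \<circ> cycle_of_list [x, y]"
    by (rule cycle_of_list_conj) (use \<open>x \<noteq> y\<close> bij_cycle_of_list in auto)
  finally show ?thesis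
    unfolding z by (simp only: o_assoc cycle_of_list.simps comp_id)
qed

text \<open>
  A function invariant under a cycle is constant on its support, which is a single orbit.
\<close>

lemma cycle_invariant_constant:
  assumes "distinct cs" "\<And>x. x \<in> set cs \<Longrightarrow> h (cycle_of_list cs x) = h x" "x \<in> set cs"
  shows "h x = h (hd cs)"
proof -
  let ?p = "cycle_of_list cs"
  have hd: "hd cs \<in> set cs"
    using assms(3) by (cases cs) auto
  have pow: "(?p ^^ i) (hd cs) \<in> set cs \<and> h ((?p ^^ i) (hd cs)) = h (hd cs)" for i
    by (induction i) (simp_all add: hd assms(2))
  obtain i where i: "i < length cs" "x = cs ! i"
    using assms(3) by (metis in_set_conv_nth)
  have "(?p ^^ i) (hd cs) = hd (map (?p ^^ i) cs)"
    using hd by (cases cs) auto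
  also have "\<dots> = hd (rotate i cs)"
    using cyclic_rotation[OF assms(1), of i] by simp
  also have "\<dots> = x"
    using i by (metis hd_rotate_conv_nth length_greater_0_conv mod_less order_le_less_trans zero_le)
  finally show ?thesis
    using pow[of i] by simp
qed

section \<open>Products of disjoint cycles\<close>

definition product_of_cycles :: "'a list list \<Rightarrow> 'a \<Rightarrow> 'a" where
  "product_of_cycles css = foldr (\<circ>) (map cycle_of_list css) id"

lemma product_of_cycles_simps [simp]:
  "product_of_cycles [] = id"
  "product_of_cycles (cs # css) = cycle_of_list cs \<circ> product_of_cycles css"
  unfolding product_of_cycles_def by simp_all

lemma product_of_cycles_append:
  "product_of_cycles (xss @ yss) = product_of_cycles xss \<circ> product_of_cycles yss"
  by (induction xss) (simp_all add: o_assoc)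

lemma product_of_cycles_outside:
  "x \<notin> set (concat css) \<Longrightarrow> product_of_cycles css x = x"
  by (induction css) (auto simp: id_outside_supp)

lemma product_of_cycles_commute:
  assumes "distinct cs" "distinct (concat css)" "set cs \<inter> set (concat css) = {}"
  shows "product_of_cycles css \<circ> cycle_of_list cs = cycle_of_list cs \<circ> product_of_cycles css"
  using assms
proof (induction css)
  case (Cons c css)
  have "product_of_cycles (c # css) \<circ> cycle_of_list cs
      = cycle_of_list c \<circ> (product_of_cycles css \<circ> cycle_of_list cs)"
    by (simp only: product_of_cycles_simps o_assoc)
  also have "\<dots> = (cycle_of_list c \<circ> cycle_of_list cs) \<circ> product_of_cycles css"
    using Cons by (subst Cons.IH) (auto simp only: o_assoc concat.simps distinct_append set_append)
  also have "cycle_of_list c \<circ> cycle_of_list cs = cycle_of_list cs \<circ> cycle_of_list c"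
    using Cons.prems by (intro cycles_commute) auto
  finally show ?case
    by (simp only: product_of_cycles_simps o_assoc)
qed simp

lemma product_of_cycles_to_front:
  assumes "distinct (concat (xss @ cs # yss))"
  shows "product_of_cycles (xss @ cs # yss) = product_of_cycles (cs # xss @ yss)"
proof -
  have "product_of_cycles xss \<circ> cycle_of_list cs = cycle_of_list cs \<circ> product_of_cycles xss"
    by (rule product_of_cycles_commute) (use assms in auto)
  then show ?thesis
    by (simp only: product_of_cycles_append product_of_cycles_simps o_assoc)
qed

lemma product_of_cycles_on_cycle:
  assumes "distinct (concat css)" "c \<in> set css" "x \<in> set c"
  shows "product_of_cycles css x = cycle_of_list c x"
proof -
  obtain us vs where css: "css = us @ c # vs"
    using split_list[OF assms(2)] by blast
  have "x \<notin> set (concat (us @ vs))"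
    using assms unfolding css by auto
  then have "product_of_cycles (us @ vs) x = x"
    by (rule product_of_cycles_outside)
  moreover have "product_of_cycles css = cycle_of_list c \<circ> product_of_cycles (us @ vs)"
    using product_of_cycles_to_front[of us c vs] assms(1) unfolding css by simp
  ultimately show ?thesis
    by simp
qed

lemma mset_concat_cong:
  "mset xss = mset yss \<Longrightarrow> mset (concat xss) = mset (concat yss)"
proof -
  have "mset (concat zss) = \<Sum>\<^sub># (image_mset mset (mset zss))" for zss :: "'a list list"
    by (induction zss) simp_all
  then show "mset xss = mset yss \<Longrightarrow> mset (concat xss) = mset (concat yss)"
    by simp
qed

lemma product_of_cycles_mset_cong:
  assumes "mset xss = mset yss" "distinct (concat xss)"
  shows "product_of_cycles xss = product_of_cycles yss"
  using assms
proof (induction xss arbitrary: yss)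
  case (Cons c xss)
  have "c \<in> set yss"
    using Cons.prems(1) by (metis list.set_intros(1) set_mset_mset)
  then obtain us vs where yss: "yss = us @ c # vs"
    by (meson split_list)
  have "mset (concat yss) = mset (concat (c # xss))"
    using Cons.prems(1) by (intro mset_concat_cong) simp
  then have "distinct (concat yss)"
    using Cons.prems(2) mset_eq_imp_distinct_iff by blast
  then have "product_of_cycles yss = cycle_of_list c \<circ> product_of_cycles (us @ vs)"
    unfolding yss by (subst product_of_cycles_to_front) simp_all
  also have "product_of_cycles (us @ vs) = product_of_cycles xss"
    by (rule Cons.IH[symmetric]) (use Cons.prems yss in auto)
  finally show ?case by simp
qed simp

text \<open>
  Disjoint cycles commute, so any \<open>j\<close> cycles with a given property can be collected on the left.
\<close>

lemma product_of_cycles_split: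
  assumes "distinct (concat css)" "j \<le> length (filter P css)"
  obtains xss yss where "length xss = j" "\<forall>c\<in>set xss. P c"
    "product_of_cycles css = product_of_cycles xss \<circ> product_of_cycles yss"
    "distinct (concat xss)" "distinct (concat yss)" "set (concat xss) \<inter> set (concat yss) = {}"
    "set (concat xss) \<union> set (concat yss) = set (concat css)" "set yss \<subseteq> set css"
    "length (concat xss) + length (concat yss) = length (concat css)"
    "length xss + length yss = length css"
proof -
  let ?A = "take j (filter P css)" and ?R = "drop j (filter P css) @ filter (\<lambda>c. \<not> P c) css"
  have "mset (?A @ ?R) = mset (filter P css) + mset (filter (\<lambda>c. \<not> P c) css)"
    by (metis append.assoc append_take_drop_id mset_append)
  then have mset: "mset (?A @ ?R) = mset css"
    by (metis multiset_partition mset_filter)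
  have concat: "mset (concat (?A @ ?R)) = mset (concat css)"
    by (rule mset_concat_cong[OF mset])
  have dist: "distinct (concat (?A @ ?R))"
    using assms(1) mset_eq_imp_distinct_iff[OF concat] by blast
  show thesis
  proof (rule that[of ?A ?R])
    show "product_of_cycles css = product_of_cycles ?A \<circ> product_of_cycles ?R"
      unfolding product_of_cycles_append[symmetric]
      by (rule product_of_cycles_mset_cong[OF mset[symmetric] assms(1)])
    show "length (concat ?A) + length (concat ?R) = length (concat css)"
      using mset_eq_length[OF concat] by (simp only: concat_append length_append)
    show "length ?A + length ?R = length css"
      using mset_eq_length[OF mset] by (simp only: length_append)
    show "set (concat ?A) \<union> set (concat ?R) = set (concat css)"
      using mset_eq_setD[OF concat] by (simp only: concat_append set_append)
    show "set ?R \<subseteq> set css"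
      by (auto dest: in_set_dropD)
    show "\<forall>c\<in>set ?A. P c"
      by (auto dest: in_set_takeD)
    show "length ?A = j"
      using assms(2) by simp
  qed (use dist in \<open>simp_all only: concat_append distinct_append\<close>)
qed

lemma permutation_product_of_cycles: "permutation (product_of_cycles css)"
  by (induction css)
    (simp_all only: product_of_cycles_simps permutation_id permutation_compose permutation_of_cycle)

lemma evenperm_cycle_of_list:
  "distinct cs \<Longrightarrow> cs \<noteq> [] \<Longrightarrow> evenperm (cycle_of_list cs) \<longleftrightarrow> odd (length cs)"
proof (induction cs rule: cycle_of_list.induct)
  case (1 i j cs)
  have "evenperm (cycle_of_list (i # j # cs))
      \<longleftrightarrow> evenperm (transpose i j) = evenperm (cycle_of_list (j # cs))"
    unfolding cycle_of_list.simps
    by (rule evenperm_comp[OF permutation_swap_id permutation_of_cycle])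
  also have "evenperm (transpose i j) = False"
    using 1(2) by (simp add: evenperm_swap)
  also have "evenperm (cycle_of_list (j # cs)) = odd (length (j # cs))"
    by (rule 1) (use 1(2) in auto)
  finally show ?case by simp
qed simp_all

lemma evenperm_product_of_cycles:
  assumes "\<forall>c\<in>set css. distinct c" "[] \<notin> set css"
  shows "evenperm (product_of_cycles css) \<longleftrightarrow> even (length (concat css) + length css)"
  using assms
proof (induction css)
  case (Cons c css)
  have "evenperm (product_of_cycles (c # css))
      \<longleftrightarrow> evenperm (cycle_of_list c) = evenperm (product_of_cycles css)"
    unfolding product_of_cycles_simps
    by (rule evenperm_comp[OF permutation_of_cycle permutation_product_of_cycles])
  also have "evenperm (cycle_of_list c) = odd (length c)"
    by (rule evenperm_cycle_of_list) (use Cons.prems in auto)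
  also have "evenperm (product_of_cycles css) = even (length (concat css) + length css)"
    by (rule Cons.IH) (use Cons.prems in auto)
  finally show ?case by (simp, blast)
qed simp

lemma product_of_cycles_permutes:
  "set (concat css) \<subseteq> S \<Longrightarrow> product_of_cycles css permutes S"
proof (induction css)
  case (Cons c css)
  then show ?case
    using permutes_subset[OF cycle_permutes[of c], of S]
    by (auto simp only: product_of_cycles_simps concat.simps set_append Un_subset_iff intro: permutes_compose)
qed (simp add: permutes_id[unfolded id_def[symmetric]])

lemma permutes_eq_product_of_cycles:
  assumes "\<pi> permutes S" "finite S"
  obtains css where "distinct (concat css)" "\<forall>c\<in>set css. 2 \<le> length c"
    "set (concat css) \<subseteq> S" "\<pi> = product_of_cycles css"
proof -
  have "\<exists>css. distinct (concat css) \<and> (\<forall>c\<in>set css. 2 \<le> length c) \<and> set (concat css) \<subseteq> S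
      \<and> \<pi> = product_of_cycles css"
    using cycle_decomposition[OF assms]
  proof induction
    case empty
    show ?case
      by (rule exI[of _ "[]"]) simp
  next
    case (comp I p cs)
    then obtain css where css: "distinct (concat css)" "\<forall>c\<in>set css. 2 \<le> length c"
        "set (concat css) \<subseteq> I" "p = product_of_cycles css"
      by blast
    show ?case
    proof (cases "2 \<le> length cs")
      case True
      then show ?thesis
        by (intro exI[of _ "cs # css"]) (use comp css in auto)
    next
      case False
      then have "cycle_of_list cs = id"
        by (cases cs; cases "tl cs") auto
      then show ?thesis
        by (intro exI[of _ css]) (use css in auto)
    qed
  qed
  then show thesis
    using that by blast
qed

lemma length_le_length_concat:
  "[] \<notin> set css \<Longrightarrow> length css \<le> length (concat css)"
proof (induction css)
  case (Cons c css)
  then have "length css \<le> length (concat css)" "c \<noteq> []"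
    by auto
  then show ?case by (cases c) auto
qed simp

lemma length_concat_ge:
  "\<forall>c\<in>set css. 2 \<le> length c \<Longrightarrow> 2 * length css \<le> length (concat css)"
  by (induction css) auto

text \<open>
  All cycles other than the transpositions have at least three points. So a permutation with few transpositions
  has few cycles.
\<close>

lemma length_concat_ge_transpositions:
  "\<forall>c\<in>set css. 2 \<le> length c \<Longrightarrow>
    3 * length css \<le> length (concat css) + length (filter (\<lambda>c. length c = 2) css)"
  by (induction css) auto

lemma length_concat_le_card:
  assumes "finite S" "distinct (concat css)" "set (concat css) \<subseteq> S"
  shows "length (concat css) \<le> card S"
  using card_mono[OF assms(1,3)] distinct_card[OF assms(2)] by simp

text \<open>
  The head of a cycle serves as its name: disjointness of the supports makes it unambiguous.
\<close>

lemma card_concat_Un_hd: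
  assumes "distinct (concat css)" "[] \<notin> set css" "A \<subseteq> set css"
  shows "card (\<Union>c\<in>A. set c) = (\<Sum>c\<in>A. length c)" "inj_on hd A"
proof -
  have dist: "\<And>c. c \<in> set css \<Longrightarrow> distinct c"
      "\<And>c d. c \<in> set css \<Longrightarrow> d \<in> set css \<Longrightarrow> c \<noteq> d \<Longrightarrow> set c \<inter> set d = {}"
    using assms(1) unfolding distinct_concat_iff by blast+
  have "finite A"
    using finite_subset[OF assms(3)] by simp
  then have "card (\<Union>c\<in>A. set c) = (\<Sum>c\<in>A. card (set c))"
    using dist(2) assms(3) by (intro card_UN_disjoint) auto
  also have "\<dots> = (\<Sum>c\<in>A. length c)"
    using dist(1) assms(3) by (intro sum.cong) (auto simp: distinct_card)
  finally show "card (\<Union>c\<in>A. set c) = (\<Sum>c\<in>A. length c)" .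
  show "inj_on hd A"
  proof (rule inj_onI)
    fix c d
    assume cd: "c \<in> A" "d \<in> A" "hd c = hd d"
    then have "c \<noteq> []" "d \<noteq> []"
      using assms(2,3) by auto
    then have "hd c \<in> set c \<inter> set d"
      using cd(3) by (metis IntI hd_in_set)
    then show "c = d"
      using dist(2)[of c d] cd(1,2) assms(3) by blast
  qed
qed

section \<open>Products of two cycles of the same length\<close>

text \<open>
  For a factorisation \<open>\<rho> = \<alpha> \<circ> \<beta>\<close> into two \<open>l\<close>-cycles,
  call \<open>p\<close> a link if \<open>p\<close> is moved by \<open>\<beta>\<close> to a point of the support
  of \<open>\<alpha>\<close>. At the image \<open>x\<close> of a link the two factors can be opened up and new
  points inserted: \<open>\<alpha> \<circ> \<gamma>1 \<circ> \<gamma>2 \<circ> \<beta>\<close> with cycles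
  \<open>\<gamma>1\<close> and \<open>\<gamma>2\<close> through \<open>x\<close> changes the product only near
  \<open>p\<close>. The set \<open>H\<close> keeps track of the links available for further insertions. Lists of
  length 1, whose support counts although they denote the identity, are admitted, so that fixed points take part
  in the constructions.
\<close>

definition linked_two_cycles :: "'a set \<Rightarrow> 'a set \<Rightarrow> nat \<Rightarrow> ('a \<Rightarrow> 'a) \<Rightarrow> bool" where
  "linked_two_cycles T H l \<rho> \<longleftrightarrow>
    (\<exists>as bs. distinct as \<and> distinct bs \<and> length as = l \<and> length bs = l \<and>
      set as \<subseteq> T \<and> set bs \<subseteq> T \<and> \<rho> = cycle_of_list as \<circ> cycle_of_list bs \<and>
      (\<forall>p\<in>H. p \<in> set bs \<and> cycle_of_list bs p \<in> set as))"

text \<open>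
  Rotating the two lists places the image \<open>x\<close> of a chosen link at the end of the first list and at
  the front of the second, where the insertions take place.
\<close>

lemma linked_two_cyclesE:
  assumes "linked_two_cycles T H l \<rho>" "p \<in> H"
  obtains as bs x where "distinct (as @ [x])" "distinct (x # bs)"
    "length (as @ [x]) = l" "length (x # bs) = l" "set (as @ [x]) \<subseteq> T" "set (x # bs) \<subseteq> T"
    "\<rho> = cycle_of_list (as @ [x]) \<circ> cycle_of_list (x # bs)"
    "\<And>p. p \<in> H \<Longrightarrow> p \<in> set (x # bs) \<and> cycle_of_list (x # bs) p \<in> set (as @ [x])"
    "cycle_of_list (x # bs) p = x"
proof -
  obtain as bs where d: "distinct as" "distinct bs" "length as = l" "length bs = l"
      "set as \<subseteq> T" "set bs \<subseteq> T" "\<rho> = cycle_of_list as \<circ> cycle_of_list bs"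
    and H: "\<And>p. p \<in> H \<Longrightarrow> p \<in> set bs \<and> cycle_of_list bs p \<in> set as"
    using assms(1) unfolding linked_two_cycles_def by blast
  let ?x = "cycle_of_list bs p"
  have x: "?x \<in> set as" "?x \<in> set bs"
    using H[OF assms(2)] by simp_all
  obtain as' where as': "distinct (as' @ [?x])" "set (as' @ [?x]) = set as"
      "cycle_of_list (as' @ [?x]) = cycle_of_list as" "length (as' @ [?x]) = length as"
    by (rule rotate_to_back[OF d(1) x(1)])
  obtain bs' where bs': "distinct (?x # bs')" "set (?x # bs') = set bs"
      "cycle_of_list (?x # bs') = cycle_of_list bs" "length (?x # bs') = length bs"
    by (rule rotate_to_front[OF d(2) x(2)])
  show thesis
    by (rule that[of as' ?x bs']) (use as' bs' d H in auto)
qed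

text \<open>
  Lengthening the cycle of \<open>\<rho>\<close> through a link \<open>p\<close> by two new points costs either
  one or two in the length of the factors. This freedom is what makes every length between the smallest possible
  one and the number of points attainable. With \<open>x\<close> the image of \<open>p\<close>, the 3-cycle
  \<open>[x, b, a]\<close> is inserted between the factors, and it is written either as a product of two
  transpositions through \<open>x\<close> or as a product of two 3-cycles on \<open>x\<close>, \<open>a\<close>,
  \<open>b\<close>. The link \<open>p\<close> is used up, but the new point \<open>b\<close>, which lies in the
  same cycle of the product, replaces it.
\<close>

lemma linked_two_cycles_grow:
  assumes "linked_two_cycles T (insert p H) l \<rho>" "p \<notin> H" "a \<notin> T" "b \<notin> T" "a \<noteq> b"
  shows "linked_two_cycles (insert a (insert b T)) (insert b H) (l + 1) (\<rho> \<circ> cycle_of_list [p, b, a])"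
    and "linked_two_cycles (insert a (insert b T)) (insert b H) (l + 2) (\<rho> \<circ> cycle_of_list [p, b, a])"
proof -
  obtain as bs x where d: "distinct (as @ [x])" "distinct (x # bs)"
    "length (as @ [x]) = l" "length (x # bs) = l" "set (as @ [x]) \<subseteq> T" "set (x # bs) \<subseteq> T"
    and \<rho>: "\<rho> = cycle_of_list (as @ [x]) \<circ> cycle_of_list (x # bs)"
    and H: "\<And>p'. p' \<in> insert p H \<Longrightarrow>
        p' \<in> set (x # bs) \<and> cycle_of_list (x # bs) p' \<in> set (as @ [x])"
    and px: "cycle_of_list (x # bs) p = x"
    by (rule linked_two_cyclesE[OF assms(1), of p]) blast+
  let ?\<beta> = "cycle_of_list (x # bs)"
  have new: "a \<notin> set as" "a \<notin> set bs" "a \<noteq> x" "b \<notin> set as" "b \<notin> set bs" "b \<noteq> x"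
    using d assms(3,4) by auto
  have "p \<in> T"
    using H[of p] d(6) by auto
  then have p: "p \<noteq> a" "p \<noteq> b"
    using assms by auto
  have fixed: "?\<beta> a = a" "?\<beta> b = b"
    using new by (auto intro!: id_outside_supp)
  have "cycle_of_list (map ?\<beta> [p, b, a]) \<circ> ?\<beta> = ?\<beta> \<circ> cycle_of_list [p, b, a]"
    by (rule cycle_of_list_conj) (use p assms(5) bij_cycle_of_list in auto)
  then have conj: "\<rho> \<circ> cycle_of_list [p, b, a]
      = cycle_of_list (as @ [x]) \<circ> cycle_of_list [x, b, a] \<circ> ?\<beta>"
    unfolding \<rho> by (simp only: list.map px fixed o_assoc[symmetric])
  have Hx: "?\<beta> h \<noteq> x" "?\<beta> h \<in> set as" "h \<in> set (x # bs)" "?\<beta> h \<noteq> a" "?\<beta> h \<noteq> b" if "h \<in> H" for h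
  proof -
    show 1: "?\<beta> h \<noteq> x"
      using px that assms(2) by (metis cycle_of_list_eq_iff)
    show 2: "?\<beta> h \<in> set as"
      using H[of h] that 1 by auto
    show "h \<in> set (x # bs)"
      using H[of h] that by blast
    show "?\<beta> h \<noteq> a" "?\<beta> h \<noteq> b"
      using 2 new by auto
  qed
  show "linked_two_cycles (insert a (insert b T)) (insert b H) (l + 1) (\<rho> \<circ> cycle_of_list [p, b, a])"
    unfolding linked_two_cycles_def
  proof (intro exI conjI)
    have "cycle_of_list (as @ [x, a]) \<circ> cycle_of_list (b # x # bs)
        = cycle_of_list (as @ [x]) \<circ> (cycle_of_list [x, a] \<circ> cycle_of_list [b, x]) \<circ> ?\<beta>"
      using cycle_of_list_append[of as x "[a]"] by (simp add: o_assoc)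
    also have "cycle_of_list [x, a] \<circ> cycle_of_list [b, x] = cycle_of_list [x, b, a]"
      using new assms(5) by (auto simp: fun_eq_iff transpose_def)
    finally show "\<rho> \<circ> cycle_of_list [p, b, a] = cycle_of_list (as @ [x, a]) \<circ> cycle_of_list (b # x # bs)"
      unfolding conj by (rule sym)
    show "\<forall>h\<in>insert b H. h \<in> set (b # x # bs) \<and> cycle_of_list (b # x # bs) h \<in> set (as @ [x, a])"
    proof
      fix h
      assume "h \<in> insert b H"
      then consider "h = b" | "h \<in> H" by blast
      then show "h \<in> set (b # x # bs) \<and> cycle_of_list (b # x # bs) h \<in> set (as @ [x, a])"
        by cases (use Hx fixed in \<open>auto simp: transpose_def\<close>)
    qed
  qed (use d new assms(5) in auto)
  show "linked_two_cycles (insert a (insert b T)) (insert b H) (l + 2) (\<rho> \<circ> cycle_of_list [p, b, a])"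
    unfolding linked_two_cycles_def
  proof (intro exI conjI)
    have "cycle_of_list (as @ [x, a, b]) \<circ> cycle_of_list (a # b # x # bs)
        = cycle_of_list (as @ [x]) \<circ> (cycle_of_list [x, a, b] \<circ> cycle_of_list [a, b, x]) \<circ> ?\<beta>"
      using cycle_of_list_append[of as x "[a, b]"] by (simp add: o_assoc)
    also have "cycle_of_list [x, a, b] \<circ> cycle_of_list [a, b, x] = cycle_of_list [x, b, a]"
      using new assms(5) by (auto simp: fun_eq_iff transpose_def)
    finally show "\<rho> \<circ> cycle_of_list [p, b, a]
        = cycle_of_list (as @ [x, a, b]) \<circ> cycle_of_list (a # b # x # bs)"
      unfolding conj by (rule sym)
    show "\<forall>h\<in>insert b H. h \<in> set (a # b # x # bs) \<and>
        cycle_of_list (a # b # x # bs) h \<in> set (as @ [x, a, b])"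
    proof
      fix h
      assume "h \<in> insert b H"
      then consider "h = b" | "h \<in> H" by blast
      then show "h \<in> set (a # b # x # bs) \<and>
          cycle_of_list (a # b # x # bs) h \<in> set (as @ [x, a, b])"
        by cases (use Hx fixed in \<open>auto simp: transpose_def\<close>)
    qed
  qed (use d new assms(5) in auto)
qed

text \<open>
  For factorisations on disjoint sets, the two left factors and the two right factors are fused by the same
  transposition \<open>(x y)\<close>, where \<open>x\<close> and \<open>y\<close> are images of links. It
  appears twice in the product, next to itself, and cancels.
\<close>

lemma linked_two_cycles_disjoint:
  assumes "linked_two_cycles T H l \<rho>" "linked_two_cycles T' H' l' \<rho>'"
    and "T \<inter> T' = {}" "H \<noteq> {}" "H' \<noteq> {}"
  shows "linked_two_cycles (T \<union> T') (H \<union> H') (l + l') (\<rho> \<circ> \<rho>')"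
proof -
  obtain p p' where p: "p \<in> H" "p' \<in> H'"
    using assms by blast
  obtain as bs x where d: "distinct (as @ [x])" "distinct (x # bs)"
    "length (as @ [x]) = l" "length (x # bs) = l" "set (as @ [x]) \<subseteq> T" "set (x # bs) \<subseteq> T"
    and \<rho>: "\<rho> = cycle_of_list (as @ [x]) \<circ> cycle_of_list (x # bs)"
    and H: "\<And>p. p \<in> H \<Longrightarrow> p \<in> set (x # bs) \<and> cycle_of_list (x # bs) p \<in> set (as @ [x])"
    by (rule linked_two_cyclesE[OF assms(1) p(1)]) blast+
  obtain as' bs' y where d': "distinct (as' @ [y])" "distinct (y # bs')"
    "length (as' @ [y]) = l'" "length (y # bs') = l'" "set (as' @ [y]) \<subseteq> T'" "set (y # bs') \<subseteq> T'"
    and \<rho>': "\<rho>' = cycle_of_list (as' @ [y]) \<circ> cycle_of_list (y # bs')"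
    and H': "\<And>p. p \<in> H' \<Longrightarrow> p \<in> set (y # bs') \<and> cycle_of_list (y # bs') p \<in> set (as' @ [y])"
    by (rule linked_two_cyclesE[OF assms(2) p(2)]) blast+
  let ?\<alpha> = "cycle_of_list (as @ [x])" and ?\<beta> = "cycle_of_list (x # bs)"
    and ?\<alpha>' = "cycle_of_list (as' @ [y])" and ?\<beta>' = "cycle_of_list (y # bs')"
  have disj: "set (as @ [x]) \<inter> set (as' @ [y]) = {}" "set (x # bs) \<inter> set (y # bs') = {}"
      "set (x # bs) \<inter> set (as' @ [y]) = {}"
    using d(5,6) d'(5,6) assms(3) by blast+
  have \<alpha>: "cycle_of_list (as @ x # as' @ [y]) = ?\<alpha> \<circ> ?\<alpha>' \<circ> transpose x y"
    by (rule cycle_of_list_append_back[OF d(1) d'(1) disj(1)])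
  have \<beta>: "cycle_of_list (x # bs @ y # bs') = transpose x y \<circ> ?\<beta> \<circ> ?\<beta>'"
    by (rule cycle_of_list_append_front[OF d(2)]) (use disj in auto)
  have comm: "?\<beta> \<circ> ?\<alpha>' = ?\<alpha>' \<circ> ?\<beta>"
    by (rule cycles_commute[OF d(2) d'(1) disj(3)])
  have "\<rho> \<circ> \<rho>' = ?\<alpha> \<circ> (?\<beta> \<circ> ?\<alpha>') \<circ> ?\<beta>'"
    unfolding \<rho> \<rho>' by (simp only: o_assoc)
  also have "\<dots> = ?\<alpha> \<circ> ?\<alpha>' \<circ> (transpose x y \<circ> transpose x y) \<circ> ?\<beta> \<circ> ?\<beta>'"
    unfolding comm by (simp only: o_assoc transpose_comp_involutory comp_id)
  also have "\<dots> = cycle_of_list (as @ x # as' @ [y]) \<circ> cycle_of_list (x # bs @ y # bs')"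
    unfolding \<alpha> \<beta> by (simp only: o_assoc)
  finally have prod: "\<rho> \<circ> \<rho>' = cycle_of_list (as @ x # as' @ [y]) \<circ> cycle_of_list (x # bs @ y # bs')" .
  show ?thesis
    unfolding linked_two_cycles_def
  proof (intro exI conjI)
    show "\<rho> \<circ> \<rho>' = cycle_of_list (as @ x # as' @ [y]) \<circ> cycle_of_list (x # bs @ y # bs')"
      by (rule prod)
    show "\<forall>h\<in>H \<union> H'. h \<in> set (x # bs @ y # bs') \<and>
        cycle_of_list (x # bs @ y # bs') h \<in> set (as @ x # as' @ [y])"
    proof
      fix h
      assume h: "h \<in> H \<union> H'"
      show "h \<in> set (x # bs @ y # bs') \<and>
          cycle_of_list (x # bs @ y # bs') h \<in> set (as @ x # as' @ [y])"
      proof (cases "h \<in> H")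
        case True
        then have "h \<notin> set (y # bs')"
          using H[OF True] disj by blast
        then have "?\<beta>' h = h"
          by (rule id_outside_supp)
        then show ?thesis
          unfolding \<beta> using H[OF True] by (auto simp: transpose_def)
      next
        case False
        then have h': "h \<in> H'"
          using h by blast
        then have "?\<beta>' h \<notin> set (x # bs)"
          using H'[OF h'] disj by blast
        then have "?\<beta> (?\<beta>' h) = ?\<beta>' h"
          by (rule id_outside_supp)
        then show ?thesis
          unfolding \<beta> using H'[OF h'] by (auto simp: transpose_def)
      qed
    qed
  qed (use d d' disj in auto)
qed

lemma linked_two_cycles_fixed_point: "linked_two_cycles {x} {x} 1 id"
  unfolding linked_two_cycles_def by (rule exI[of _ "[x]"], rule exI[of _ "[x]"]) simp

text \<open>
  Cycles of even length are odd permutations, so they occur in pairs; this is the smallest pair.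
\<close>

lemma linked_two_cycles_transpositions:
  assumes "distinct [u, v, x, y]"
  shows "linked_two_cycles {u, v, x, y} {u, x} 3 (transpose u v \<circ> transpose x y)"
    and "linked_two_cycles {u, v, x, y} {u, x} 4 (transpose u v \<circ> transpose x y)"
proof -
  show "linked_two_cycles {u, v, x, y} {u, x} 3 (transpose u v \<circ> transpose x y)"
    unfolding linked_two_cycles_def
    by (rule exI[of _ "[v, u, y]"], rule exI[of _ "[u, y, x]"])
      (use assms in \<open>auto simp: fun_eq_iff transpose_def\<close>)
  show "linked_two_cycles {u, v, x, y} {u, x} 4 (transpose u v \<circ> transpose x y)"
    unfolding linked_two_cycles_def
    by (rule exI[of _ "[u, x, v, y]"], rule exI[of _ "[u, x, v, y]"])
      (use assms in \<open>auto simp: fun_eq_iff transpose_def\<close>)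
qed

text \<open>
  The induction removes points: two adjacent points of a cycle with at least three of them, or a fixed point, or
  two transpositions if there is nothing else. The first removal lowers \<open>m + c\<close> by 2, the second
  by 2 and the third by 6. The length of the factors falls by at least half of this, and if needed by one more,
  so that it does not exceed the number of points that are left. The links needed to put the points back are the
  first entries of the cycles: the cycle \<open>b # a # ds @ [p]\<close> comes from
  \<open>p # ds\<close> by an insertion at \<open>p\<close>, and \<open>b\<close> is the new link.
\<close>

lemma product_of_two_cycles:
  assumes "distinct (concat css)" "[] \<notin> set css" "css \<noteq> []"
    and "even (length (concat css) + length css)"
    and "length (concat css) + length css \<le> 2 * l" "l \<le> length (concat css)"
  shows "linked_two_cycles (set (concat css)) (hd ` set css) l (product_of_cycles css)"
  using assms
proof (induction "length (concat css)" arbitrary: css l rule: less_induct)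
  case less
  let ?goal = "linked_two_cycles (set (concat css)) (hd ` set css) l (product_of_cycles css)"
  consider (long) "\<exists>c\<in>set css. length c \<ge> 3" | (fixed) "\<exists>c\<in>set css. length c = 1"
    | (transpositions) "\<forall>c\<in>set css. length c = 2"
  proof -
    have "length c = 1 \<or> length c = 2 \<or> length c \<ge> 3" if "c \<in> set css" for c
    proof -
      have "c \<noteq> []"
        using that less.prems(2) by auto
      then have "length c > 0"
        by simp
      then show ?thesis
        by linarith
    qed
    then show ?thesis
      using that by blast
  qed
  then show ?goal
  proof cases
    case long
    then obtain c where c: "c \<in> set css" "length c \<ge> 3" by blast
    obtain xss yss where css: "css = xss @ c # yss"
      using split_list[OF c(1)] by blast
    obtain b a c2 where c2: "c = b # a # c2" "c2 \<noteq> []"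
      using c(2) by (cases c; cases "tl c"; cases "tl (tl c)") auto
    then obtain ds p where ds: "c = b # a # ds @ [p]"
      by (metis append_butlast_last_id)
    let ?R = "xss @ yss"
    let ?css = "(p # ds) # ?R"
    let ?R' = "product_of_cycles ?R"
    have dist: "distinct (b # a # ds @ [p])" "distinct (concat ?R)"
        "set (b # a # ds @ [p]) \<inter> set (concat ?R) = {}" "[] \<notin> set ?R"
      using less.prems(1,2) unfolding css ds by auto
    have len: "length (concat css) = length (concat ?css) + 2" "length css = length ?css"
      unfolding css ds by auto
    have "length ?R \<le> length (concat ?R)"
      using dist(4) by (rule length_le_length_concat)
    then have short: "length css + 2 \<le> length (concat css)"
      unfolding css ds by simp
    have IH: "linked_two_cycles (set (concat ?css)) (hd ` set ?css) l' (product_of_cycles ?css)"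
      if "length (concat ?css) + length ?css \<le> 2 * l'" "l' \<le> length (concat ?css)" for l'
    proof (rule less.hyps)
      show "even (length (concat ?css) + length ?css)"
        using less.prems(4) unfolding len by simp
    qed (use that dist len in auto)
    have hds: "hd ` set ?css = insert p (hd ` set ?R)" "hd ` set css = insert b (hd ` set ?R)"
      unfolding css ds by auto
    have sets: "set (concat css) = insert a (insert b (set (concat ?css)))"
      unfolding css ds by auto
    have p: "p \<notin> hd ` set ?R"
    proof
      assume "p \<in> hd ` set ?R"
      then obtain e where "e \<in> set ?R" "p = hd e" by blast
      then have "p \<in> set (concat ?R)"
        using dist(4) hd_in_set[of e] by (metis UN_I set_concat)
      then show False
        using dist(3) by auto
    qed
    have comm: "?R' \<circ> cycle_of_list [p, b, a] = cycle_of_list [p, b, a] \<circ> ?R'"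
      by (rule product_of_cycles_commute) (use dist in auto)
    have "product_of_cycles css = cycle_of_list c \<circ> ?R'"
      using product_of_cycles_to_front less.prems(1) css by (metis product_of_cycles_simps(2))
    also have "cycle_of_list c = cycle_of_list (a # ds @ [p, b])"
      using cycle_of_list_rotate1[of b "a # ds @ [p]"] dist(1) ds
      by (simp only: append.simps append_assoc)
    also have "\<dots> = cycle_of_list (ds @ p # [b, a])"
      using cycle_of_list_rotate1[of a "ds @ [p, b]"] dist(1)
      by (simp only: append.simps append_assoc) auto
    also have "\<dots> = cycle_of_list (ds @ [p]) \<circ> cycle_of_list [p, b, a]"
      by (rule cycle_of_list_append)
    also have "cycle_of_list (ds @ [p]) = cycle_of_list (p # ds)"
      by (rule cycle_of_list_rotate1) (use dist in auto)
    also have "cycle_of_list (p # ds) \<circ> cycle_of_list [p, b, a] \<circ> ?R'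
        = cycle_of_list (p # ds) \<circ> (?R' \<circ> cycle_of_list [p, b, a])"
      unfolding comm by (simp only: o_assoc)
    also have "\<dots> = product_of_cycles ?css \<circ> cycle_of_list [p, b, a]"
      by (simp only: product_of_cycles_simps o_assoc)
    finally have prod: "product_of_cycles css = product_of_cycles ?css \<circ> cycle_of_list [p, b, a]" .
    have l2: "2 \<le> l"
      using short less.prems(5) unfolding len by simp
    have ab: "a \<notin> set (concat ?css)" "b \<notin> set (concat ?css)" "a \<noteq> b"
      using dist by auto
    \<comment> \<open>One less if the remaining points still admit it; otherwise \<open>l\<close> is the number of points.\<close>
    show ?goal
    proof (cases "l \<le> length (concat ?css) + 1")
      case True
      have "linked_two_cycles (set (concat ?css)) (insert p (hd ` set ?R)) (l - 1) (product_of_cycles ?css)"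
        unfolding hds(1)[symmetric] by (rule IH) (use True less.prems(5,6) len in auto)
      from linked_two_cycles_grow(1)[OF this p ab] show ?thesis
        unfolding sets[symmetric] hds(2)[symmetric] prod[symmetric] using l2 by simp
    next
      case False
      have "linked_two_cycles (set (concat ?css)) (insert p (hd ` set ?R)) (l - 2) (product_of_cycles ?css)"
        unfolding hds(1)[symmetric] by (rule IH) (use False less.prems(5,6) len short in auto)
      from linked_two_cycles_grow(2)[OF this p ab] have
        "linked_two_cycles (set (concat css)) (hd ` set css) (l - 2 + 2) (product_of_cycles css)"
        unfolding sets[symmetric] hds(2)[symmetric] prod[symmetric] .
      then show ?thesis
        by (simp only: le_add_diff_inverse2[OF l2])
    qed
  next
    case fixed
    then obtain x xss yss where css: "css = xss @ [x] # yss"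
      by (metis length_Suc_conv length_0_conv One_nat_def split_list)
    let ?R = "xss @ yss"
    have dist: "x \<notin> set (concat ?R)" "distinct (concat ?R)" "[] \<notin> set ?R"
      using less.prems(1,2) unfolding css by auto
    have prod: "product_of_cycles css = id \<circ> product_of_cycles ?R"
      using product_of_cycles_to_front[of xss "[x]" yss] less.prems(1) css by simp
    show ?goal
    proof (cases "?R = []")
      case True
      then have "css = [[x]]" "l = 1"
        using css less.prems(5,6) by auto
      then show ?thesis
        using linked_two_cycles_fixed_point[of x] by simp
    next
      case False
      have "linked_two_cycles (set (concat ?R)) (hd ` set ?R) (l - 1) (product_of_cycles ?R)"
        by (rule less.hyps) (use less.prems dist False css in auto)
      with linked_two_cycles_fixed_point[of x]
      have "linked_two_cycles ({x} \<union> set (concat ?R)) ({x} \<union> hd ` set ?R) (1 + (l - 1))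
          (id \<circ> product_of_cycles ?R)"
        by (rule linked_two_cycles_disjoint) (use dist False in auto)
      moreover have "1 + (l - 1) = l"
        using less.prems(3,5) css by simp
      moreover have "{x} \<union> set (concat ?R) = set (concat css)" "{x} \<union> hd ` set ?R = hd ` set css"
        unfolding css by auto
      ultimately show ?thesis
        unfolding prod by simp
    qed
  next
    case transpositions
    have m: "length (concat css) = 2 * length css"
      using transpositions by (induction css) auto
    have "even (length css)"
      using less.prems(4) unfolding m by simp
    then obtain c c' R where css: "css = c # c' # R"
      using less.prems(3) by (cases css; cases "tl css") auto
    obtain u v x y where c: "c = [u, v]" "c' = [x, y]"
      using transpositions unfolding css
      by (auto simp: length_Suc_conv numeral_2_eq_2)
    have dist: "distinct [u, v, x, y]" "distinct (concat R)"
        "{u, v, x, y} \<inter> set (concat R) = {}" "[] \<notin> set R"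
      using less.prems(1,2) unfolding css c by auto
    have prod: "product_of_cycles css = transpose u v \<circ> transpose x y \<circ> product_of_cycles R"
      unfolding css c by (simp add: o_assoc)
    have sets: "set (concat css) = {u, v, x, y} \<union> set (concat R)"
        "hd ` set css = {u, x} \<union> hd ` set R"
      unfolding css c by auto
    have mR: "length (concat R) = 2 * length R" "length css = length R + 2"
      using m unfolding css c by auto
    have bounds: "3 * length R + 6 \<le> 2 * l" "l \<le> 2 * length R + 4" "even (length R)"
      using less.prems(5,6) \<open>even (length css)\<close> unfolding m mR by auto
    show ?goal
    proof (cases "R = []")
      case True
      then have "l = 3 \<or> l = 4"
        using bounds by auto
      then show ?thesis
        using linked_two_cycles_transpositions[OF dist(1)] True unfolding prod sets by auto
    next
      case False
      have IH: "linked_two_cycles (set (concat R)) (hd ` set R) l' (product_of_cycles R)"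
        if "3 * length R \<le> 2 * l'" "l' \<le> 2 * length R" for l'
        by (rule less.hyps) (use that dist bounds False mR m in auto)
      have "length R > 0"
        using False by simp
      then have "length R \<ge> 2"
        using bounds(3) by presburger
      have "linked_two_cycles (set (concat css)) (hd ` set css) (d + (l - d)) (product_of_cycles css)"
        if "d = 3 \<or> d = 4" "3 * length R \<le> 2 * (l - d)" "l - d \<le> 2 * length R" for d
        unfolding prod sets
        by (rule linked_two_cycles_disjoint)
          (use linked_two_cycles_transpositions[OF dist(1)] that IH dist False in auto)
      from this[of 3] this[of 4] show ?thesis
        using bounds \<open>length R \<ge> 2\<close> by (cases "l - 3 \<le> 2 * length R") auto
    qed
  qed
qed

section \<open>Products of k cycles of the same length\<close>

text \<open>
  Let \<open>\<sigma>\<close> run through whole cycles of the permutation and then through an initial segment of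
  one more cycle, until it has length \<open>l\<close>. The inverse of \<open>\<sigma>\<close> sends the
  successor of a point back to the point, so multiplying by it fixes all points of \<open>\<sigma>\<close> but
  the last in each run, and it merges what is left of the \<open>h\<close> cycles involved into a single cycle
  \<open>D\<close>. This removes \<open>l - h\<close> points and \<open>h - 1\<close> cycles, in total
  \<open>l - 1\<close> whatever \<open>h\<close> is. The condition \<open>last \<sigma> = hd D\<close> is
  what the induction needs in order to prepend a further cycle.
\<close>

lemma product_of_cycles_peel:
  assumes "distinct (concat css)" "[] \<notin> set css" "1 \<le> l" "l \<le> length (concat css)"
  shows "\<exists>\<sigma> D R. distinct \<sigma> \<and> length \<sigma> = l \<and> set \<sigma> \<subseteq> set (concat css) \<and>
    distinct (concat (D # R)) \<and> [] \<notin> set (D # R) \<and> set (concat (D # R)) \<subseteq> set (concat css) \<and>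
    length (concat (D # R)) + length (D # R) + l = length (concat css) + length css + 1 \<and>
    last \<sigma> = hd D \<and> product_of_cycles css = cycle_of_list \<sigma> \<circ> product_of_cycles (D # R)"
  using assms
proof (induction css arbitrary: l)
  case (Cons c css)
  show ?case
  proof (cases "l \<le> length c")
    case True
    let ?u = "take (l - 1) c" and ?z = "c ! (l - 1)" and ?w = "drop l c"
    have c: "c = ?u @ ?z # ?w"
      using id_take_nth_drop[of "l - 1" c] True Cons.prems(3) by simp
    have "length ?u + 1 = l"
      using True Cons.prems(3) by simp
    moreover obtain u z w where uzw: "c = u @ z # w" "length u + 1 = l"
      using c calculation by blast
    show ?thesis
    proof (intro exI conjI)
      show "product_of_cycles (c # css)
          = cycle_of_list (u @ [z]) \<circ> product_of_cycles ((z # w) # css)"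
        unfolding uzw(1) product_of_cycles_simps cycle_of_list_append[of u z w]
        by (simp only: o_assoc)
    qed (use uzw Cons.prems in auto)
  next
    case False
    obtain \<sigma> D R where IH: "distinct \<sigma>" "length \<sigma> = l - length c" "set \<sigma> \<subseteq> set (concat css)"
      "distinct (concat (D # R))" "[] \<notin> set (D # R)" "set (concat (D # R)) \<subseteq> set (concat css)"
      "length (concat (D # R)) + length (D # R) + (l - length c) = length (concat css) + length css + 1"
      "last \<sigma> = hd D" "product_of_cycles css = cycle_of_list \<sigma> \<circ> product_of_cycles (D # R)"
    proof -
      have "distinct (concat css)" "[] \<notin> set css" "1 \<le> l - length c" "l - length c \<le> length (concat css)"
        using Cons.prems False by auto
      from Cons.IH[OF this] show thesis
        using that by blast
    qed
    obtain u x where c: "c = u @ [x]"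
      using Cons.prems(2) by (metis list.set_intros(1) rev_exhaust)
    obtain d ds where D: "D = d # ds"
      using IH(5) by (cases D) auto
    have "\<sigma> \<noteq> []"
      using IH(2) False by auto
    then obtain v where \<sigma>: "\<sigma> = v @ [d]"
      using IH(8) unfolding D by (metis append_butlast_last_id list.sel(1))
    have disj: "set c \<inter> set (concat css) = {}" "distinct c"
      using Cons.prems(1) by auto
    then have x: "x \<notin> set (concat (D # R))"
      using IH(6) c by auto
    show ?thesis
    proof (intro exI conjI)
      have "product_of_cycles (c # css)
          = cycle_of_list (u @ [x]) \<circ> cycle_of_list (v @ [d]) \<circ> cycle_of_list D \<circ> product_of_cycles R"
        unfolding product_of_cycles_simps IH(9) c \<sigma> by (simp only: o_assoc)
      also have "cycle_of_list D = transpose x d \<circ> cycle_of_list (x # d # ds)"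
        unfolding D by (simp only: cycle_of_list.simps o_assoc transpose_comp_involutory id_comp)
      also have "cycle_of_list (x # d # ds) = cycle_of_list ((d # ds) @ [x])"
        by (rule cycle_of_list_rotate1[symmetric]) (use x IH(4) D in auto)
      also have "cycle_of_list (u @ [x]) \<circ> cycle_of_list (v @ [d])
            \<circ> (transpose x d \<circ> cycle_of_list ((d # ds) @ [x])) \<circ> product_of_cycles R
          = cycle_of_list (u @ x # v @ [d]) \<circ> product_of_cycles (((d # ds) @ [x]) # R)"
        by (subst cycle_of_list_append_back)
          (use disj c \<sigma> IH(1,3) in \<open>auto simp only: o_assoc product_of_cycles_simps\<close>)
      finally show "product_of_cycles (c # css)
          = cycle_of_list (u @ x # v @ [d]) \<circ> product_of_cycles (((d # ds) @ [x]) # R)" .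
    qed (use IH disj x c D \<sigma> False in auto)
  qed
qed simp

definition product_of_cycles_of_length :: "nat \<Rightarrow> nat \<Rightarrow> 'a set \<Rightarrow> ('a \<Rightarrow> 'a) \<Rightarrow> bool" where
  "product_of_cycles_of_length k l S \<pi> \<longleftrightarrow>
    (\<exists>ds. length ds = k \<and> (\<forall>d\<in>set ds. distinct d \<and> length d = l \<and> set d \<subseteq> S) \<and>
      \<pi> = product_of_cycles ds)"

lemma product_of_cycles_of_length_comp:
  assumes "product_of_cycles_of_length k l S \<pi>" "product_of_cycles_of_length k' l S' \<pi>'"
    and "S \<subseteq> T" "S' \<subseteq> T"
  shows "product_of_cycles_of_length (k + k') l T (\<pi> \<circ> \<pi>')"
proof -
  obtain ds ds' where "length ds = k" "\<forall>d\<in>set ds. distinct d \<and> length d = l \<and> set d \<subseteq> S"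
      "\<pi> = product_of_cycles ds" "length ds' = k'"
      "\<forall>d\<in>set ds'. distinct d \<and> length d = l \<and> set d \<subseteq> S'" "\<pi>' = product_of_cycles ds'"
    using assms(1,2) unfolding product_of_cycles_of_length_def by blast
  then show ?thesis
    unfolding product_of_cycles_of_length_def
    by (intro exI[of _ "ds @ ds'"]) (use assms(3,4) in \<open>auto simp: product_of_cycles_append; blast\<close>)
qed

text \<open>
  If a permutation moves fewer than \<open>l\<close> points, fixed points are added as cycles of length 1 until
  there are \<open>l\<close> points. There are then at most \<open>l\<close> cycles, so the sum of the two
  numbers is at most \<open>2 * l\<close>, which is harmless for two or more factors.
\<close>

lemma pad_with_fixed_points:
  assumes "finite S" "distinct (concat css)" "[] \<notin> set css" "set (concat css) \<subseteq> S" "l \<le> card S"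
  obtains css' where "distinct (concat css')" "[] \<notin> set css'" "set (concat css') \<subseteq> S"
    "product_of_cycles css' = product_of_cycles css" "l \<le> length (concat css')"
    "even (length (concat css') + length css') \<longleftrightarrow> even (length (concat css) + length css)"
    "length (concat css') + length css' \<le> max (length (concat css) + length css) (2 * l)"
proof (cases "l \<le> length (concat css)")
  case True
  show thesis
    by (rule that[of css]) (use True assms in auto)
next
  case False
  let ?m = "length (concat css)"
  have "card (set (concat css)) = ?m"
    by (rule distinct_card[OF assms(2)])
  then have "card (S - set (concat css)) = card S - ?m"
    using assms(1,4) by (subst card_Diff_subset) auto
  then obtain X where X: "X \<subseteq> S - set (concat css)" "card X = l - ?m"
    using obtain_subset_with_card_n[of "l - ?m" "S - set (concat css)"] assms(5)
    by (metis diff_le_mono)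
  obtain xs where xs: "set xs = X" "distinct xs"
    using finite_distinct_list finite_subset[OF X(1)] assms(1) by blast
  have lx: "length xs = l - ?m"
    using distinct_card[OF xs(2)] xs(1) X(2) by simp
  have concat: "concat (map (\<lambda>x. [x]) xs) = xs"
    by (induction xs) auto
  have prod: "product_of_cycles (map (\<lambda>x. [x]) xs) = id"
    by (induction xs) auto
  have "length css \<le> ?m"
    using assms(3) by (rule length_le_length_concat)
  then have l2: "length (concat (map (\<lambda>x. [x]) xs @ css)) = l"
      "length (map (\<lambda>x. [x]) xs @ css) + ?m = l + length css"
    unfolding concat_append length_append concat length_map using False lx by simp_all
  show thesis
  proof (rule that[of "map (\<lambda>x. [x]) xs @ css"])
    show "even (length (concat (map (\<lambda>x. [x]) xs @ css)) + length (map (\<lambda>x. [x]) xs @ css))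
        \<longleftrightarrow> even (?m + length css)"
      using l2 by presburger
    show "length (concat (map (\<lambda>x. [x]) xs @ css)) + length (map (\<lambda>x. [x]) xs @ css)
        \<le> max (?m + length css) (2 * l)"
      using l2 \<open>length css \<le> ?m\<close> by linarith
    show "distinct (concat (map (\<lambda>x. [x]) xs @ css))"
      using assms(2) xs X by (auto simp only: concat_append concat distinct_append)
    show "set (concat (map (\<lambda>x. [x]) xs @ css)) \<subseteq> S"
      using assms(4) xs X by (auto simp only: concat_append concat set_append)
  qed (use assms l2 prod in \<open>auto simp: product_of_cycles_append\<close>)
qed

text \<open>
  The converse of the Riemann-Hurwitz inequality. Each step splits off one \<open>l\<close>-cycle, which lowers
  both sides by \<open>l - 1\<close>; padding provides the \<open>l\<close> points that this takes.
\<close>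

theorem product_of_cycles_of_lengthI:
  assumes "finite S" "distinct (concat css)" "[] \<notin> set css" "set (concat css) \<subseteq> S"
    and "2 \<le> k" "2 \<le> l" "l \<le> card S"
    and "length (concat css) + length css \<le> k * (l - 1) + 2"
    and "even (length (concat css) + length css + k * (l - 1))"
  shows "product_of_cycles_of_length k l S (product_of_cycles css)"
  using assms(5,2,3,4,8,9)
proof (induction k arbitrary: css rule: dec_induct)
  case base
  obtain css' where css': "distinct (concat css')" "[] \<notin> set css'" "set (concat css') \<subseteq> S"
    "product_of_cycles css' = product_of_cycles css" "l \<le> length (concat css')"
    "even (length (concat css') + length css') \<longleftrightarrow> even (length (concat css) + length css)"
    "length (concat css') + length css' \<le> max (length (concat css) + length css) (2 * l)"
    by (rule pad_with_fixed_points[OF assms(1) base(1,2,3) assms(7)])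
  have "length (concat css') + length css' \<le> 2 * l"
    using css'(7) base(4) assms(6) by simp
  moreover have "even (length (concat css') + length css')"
    using css'(6) base(5) by simp
  moreover have "css' \<noteq> []"
    using css'(5) assms(6) by auto
  ultimately have "linked_two_cycles (set (concat css')) (hd ` set css') l (product_of_cycles css')"
    using css' by (intro product_of_two_cycles) auto
  then obtain as bs where "distinct as" "distinct bs" "length as = l" "length bs = l"
      "set as \<subseteq> S" "set bs \<subseteq> S" "product_of_cycles css = cycle_of_list as \<circ> cycle_of_list bs"
    using css'(3,4) unfolding linked_two_cycles_def by (metis subset_trans)
  then show ?case
    unfolding product_of_cycles_of_length_def by (intro exI[of _ "[as, bs]"]) auto
next
  case (step k)
  obtain css' where css': "distinct (concat css')" "[] \<notin> set css'" "set (concat css') \<subseteq> S"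
    "product_of_cycles css' = product_of_cycles css" "l \<le> length (concat css')"
    "even (length (concat css') + length css') \<longleftrightarrow> even (length (concat css) + length css)"
    "length (concat css') + length css' \<le> max (length (concat css) + length css) (2 * l)"
    by (rule pad_with_fixed_points[OF assms(1) step.prems(1,2,3) assms(7)])
  obtain \<sigma> css'' where \<sigma>: "distinct \<sigma>" "length \<sigma> = l" "set \<sigma> \<subseteq> set (concat css')"
    "distinct (concat css'')" "[] \<notin> set css''" "set (concat css'') \<subseteq> set (concat css')"
    "length (concat css'') + length css'' + l = length (concat css') + length css' + 1"
    "product_of_cycles css' = cycle_of_list \<sigma> \<circ> product_of_cycles css''"
  proof -
    have "1 \<le> l"
      using assms(6) by simp
    from product_of_cycles_peel[OF css'(1,2) this css'(5)] show thesis
      using that by blast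
  qed
  obtain l' where l': "l = Suc l'"
    using assms(6) by (cases l) auto
  have "l' \<le> k * l'"
    using step.hyps(1) by simp
  moreover have "length (concat css'') + length css'' + l' = length (concat css') + length css'"
    using \<sigma>(7) l' by simp
  moreover have "length (concat css') + length css' \<le> l' + k * l' + 2
      \<or> length (concat css') + length css' \<le> 2 * l' + 2"
    using css'(7) step.prems(4) unfolding l' by (auto simp: max_def split: if_splits)
  ultimately have "length (concat css'') + length css'' \<le> k * (l - 1) + 2"
    unfolding l' by (elim disjE) (simp_all only: diff_Suc_1)
  moreover have "even (length (concat css'') + length css'' + k * (l - 1))"
    using \<sigma>(7) css'(6) step.prems(5) unfolding l' by (simp, presburger)
  ultimately have "product_of_cycles_of_length k l S (product_of_cycles css'')"
    using \<sigma>(4-6) css'(3) by (intro step.IH) blast+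
  then obtain ds where "length ds = k" "\<forall>d\<in>set ds. distinct d \<and> length d = l \<and> set d \<subseteq> S"
      "product_of_cycles css'' = product_of_cycles ds"
    unfolding product_of_cycles_of_length_def by blast
  then show ?case
    unfolding product_of_cycles_of_length_def css'(4)[symmetric] \<sigma>(8)
    by (intro exI[of _ "\<sigma> # ds"]) (use \<sigma>(1-3) css'(3) in auto)
qed

section \<open>Even permutations of the critical degree\<close>

text \<open>
  The inequality of \<open>product_of_cycles_of_lengthI\<close> could only fail for \<open>k * q + 1\<close>
  cycles that use up all points. These would all be transpositions, an odd number of them.
\<close>

lemma product_of_cycles_of_length_mod3_1:
  assumes "finite S" "card S = 2 * k * q + 2" "1 \<le> q" "2 \<le> k" "even (k * q)"
    and "distinct (concat css)" "\<forall>c\<in>set css. 2 \<le> length c" "set (concat css) \<subseteq> S"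
    and "even (length (concat css) + length css)"
  shows "product_of_cycles_of_length k (3 * q + 1) S (product_of_cycles css)"
proof (rule product_of_cycles_of_lengthI)
  let ?m = "length (concat css)" and ?c = "length css"
  have c: "2 * ?c \<le> ?m"
    by (rule length_concat_ge[OF assms(7)])
  have m: "?m \<le> 2 * (k * q) + 2"
    using length_concat_le_card[OF assms(1,6,8)] unfolding assms(2) by simp
  have "?m + ?c \<le> 3 * (k * q) + 2"
  proof (cases "?c \<le> k * q")
    case True
    then show ?thesis
      using m by linarith
  next
    case False
    then have "?c = k * q + 1" "?m = 2 * (k * q) + 2"
      using c m by linarith+
    then show ?thesis
      using assms(5,9) by simp
  qed
  then show "?m + ?c \<le> k * (3 * q + 1 - 1) + 2"
    by simp
  show "even (?m + ?c + k * (3 * q + 1 - 1))"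
    using assms(5,9) by simp
  have "2 * q \<le> k * q"
    using assms(4) by simp
  then show "3 * q + 1 \<le> card S"
    unfolding assms(2) mult.assoc using assms(3) by linarith
qed (use assms in auto)

text \<open>
  For \<open>k \<le> 5\<close>, the bound \<open>2 * c \<le> m\<close> and parity give the inequality of
  \<open>product_of_cycles_of_lengthI\<close>. For larger \<open>k\<close> and at most
  \<open>4 * q + 1\<close> transpositions, the bound \<open>3 * c \<le> m + 4 * q + 1\<close> and
  parity do. Otherwise \<open>4 * q + 2\<close> transpositions are written as a product of four
  \<open>l\<close>-cycles; for them that inequality is an equality. They use up \<open>8 * q + 4\<close>
  points, which is the difference between the critical degrees for \<open>k\<close> and \<open>k - 4\<close>.
\<close>

lemma product_of_cycles_of_length_mod3_2:
  assumes "1 \<le> q" "2 \<le> k" "even (k * (3 * q + 1))"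
    and "finite S" "card S = k * (2 * q + 1) + (if k mod 4 = 1 then 0 else 1)"
    and "distinct (concat css)" "\<forall>c\<in>set css. 2 \<le> length c" "set (concat css) \<subseteq> S"
    and "even (length (concat css) + length css)"
  shows "product_of_cycles_of_length k (3 * q + 2) S (product_of_cycles css)"
  using assms(2-)
proof (induction k arbitrary: S css rule: less_induct)
  case (less k)
  let ?m = "length (concat css)" and ?c = "length css"
  let ?a = "length (filter (\<lambda>c. length c = 2) css)"
  have m: "?m \<le> k * (2 * q + 1) + (if k mod 4 = 1 then 0 else 1)"
    using length_concat_le_card[OF less.prems(3,5,7)] less.prems(4) by simp
  have c: "2 * ?c \<le> ?m" "3 * ?c \<le> ?m + ?a"
    using length_concat_ge[OF less.prems(6)] length_concat_ge_transpositions[OF less.prems(6)] by blast+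
  have q: "3 * q + 2 \<le> 2 * (2 * q + 1)"
    by simp
  have "2 * (2 * q + 1) \<le> k * (2 * q + 1)"
    by (rule mult_right_mono[OF less.prems(1)]) simp
  then have l: "3 * q + 2 \<le> card S"
    unfolding less.prems(4) by (intro trans_le_add1 order_trans[OF q])
  show ?case
  proof (cases "k \<ge> 6 \<and> ?a \<ge> 4 * q + 2")
    case True
    obtain A R where A: "length A = 4 * q + 2" "\<forall>c\<in>set A. length c = 2"
      and prod: "product_of_cycles css = product_of_cycles A \<circ> product_of_cycles R"
      and dist: "distinct (concat A)" "distinct (concat R)" "set (concat A) \<inter> set (concat R) = {}"
      and sets: "set (concat A) \<union> set (concat R) = set (concat css)" "set R \<subseteq> set css"
      and len: "length (concat A) + length (concat R) = ?m" "length A + length R = ?c"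
      by (rule product_of_cycles_split[OF less.prems(5) conjunct2[OF True]])
    have "length (concat A) = 2 * length A"
      using A(2) by (induction A) auto
    then have mA: "length (concat A) = 8 * q + 4"
      using A(1) by simp
    let ?T = "set (concat A)"
    have T: "?T \<subseteq> S" "card ?T = 8 * q + 4"
      using sets(1) less.prems(7) distinct_card[OF dist(1)] mA by auto
    obtain i where i: "k = i + 4" "2 \<le> i"
    proof -
      have "k = (k - 4) + 4" "2 \<le> k - 4"
        using conjunct1[OF True] by linarith+
      then show thesis
        by (rule that)
    qed
    have "product_of_cycles_of_length i (3 * q + 2) (S - ?T) (product_of_cycles R)"
    proof (rule less.IH)
      show "i < k" "2 \<le> i" "finite (S - ?T)"
        using i less.prems(3) by simp_all
      show "even (i * (3 * q + 1))"
        using less.prems(2) unfolding i(1) by simp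
      have "card (S - ?T) = card S - (8 * q + 4)"
        using T by (simp add: card_Diff_subset)
      then show "card (S - ?T) = i * (2 * q + 1) + (if i mod 4 = 1 then 0 else 1)"
        unfolding less.prems(4) i(1) by (simp add: algebra_simps)
      show "distinct (concat R)" "\<forall>c\<in>set R. 2 \<le> length c"
        using dist(2) sets(2) less.prems(6) by blast+
      show "set (concat R) \<subseteq> S - ?T"
        using dist(3) sets(1) less.prems(7) by blast
      show "even (length (concat R) + length R)"
        using less.prems(8) len mA A(1) by presburger
    qed
    moreover have "product_of_cycles_of_length 4 (3 * q + 2) ?T (product_of_cycles A)"
    proof (rule product_of_cycles_of_lengthI)
      show "[] \<notin> set A"
        using A(2) by force
    qed (use A(1) mA T dist(1) in simp_all)
    ultimately have "product_of_cycles_of_length (4 + i) (3 * q + 2) S (product_of_cycles css)"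
      unfolding prod by (intro product_of_cycles_of_length_comp[OF _ _ T(1) Diff_subset])
    then show ?thesis
      unfolding i(1) by (simp only: add.commute)
  next
    case False
    have "?m + ?c \<le> k * (3 * q + 1) + 2"
    proof (cases "k \<ge> 6")
      case True
      then have a: "?a \<le> 4 * q + 1"
        using False by simp
      have "k = 4 + (k - 4)" "q = 1 + (q - 1)"
        using True assms(1) by linarith+
      then obtain i j where ij: "k = 4 + i" "q = 1 + j"
        by blast
      show ?thesis
      proof (rule ccontr)
        assume "\<not> ?thesis"
        then have "k * (3 * q + 1) + 4 \<le> ?m + ?c"
          using less.prems(2,8) by presburger
        moreover have "3 * (?m + ?c) \<le> 4 * ?m + (4 * q + 1)"
          using c(2) a by simp
        moreover have "?m \<le> k * (2 * q + 1) + 1"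
          using m by (simp split: if_splits)
        moreover have "3 * (x + 4) \<le> 4 * z + y" if "x + 4 \<le> s" "3 * s \<le> 4 * m + y" "m \<le> z"
          for x y z s m :: nat
        proof -
          have "3 * (x + 4) \<le> 3 * s"
            by (rule mult_le_mono2[OF that(1)])
          then show ?thesis
            using that(2,3) by linarith
        qed
        ultimately have "3 * (k * (3 * q + 1) + 4) \<le> 4 * (k * (2 * q + 1) + 1) + (4 * q + 1)"
          by blast
        then show False
          unfolding ij by (simp add: algebra_simps)
      qed
    next
      case False
      then consider "k = 2" | "k = 3" | "k = 4" | "k = 5"
        using less.prems(1) by linarith
      then show ?thesis
        by cases (use m c(1) less.prems(2,8) in \<open>simp_all, presburger+\<close>)
    qed
    then show ?thesis
      by (intro product_of_cycles_of_lengthI) (use less.prems l in \<open>force+\<close>)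
  qed
qed

section \<open>The Riemann-Hurwitz inequality\<close>

fun path_edges :: "'a list \<Rightarrow> ('a \<times> 'a) list" where
  "path_edges (i # j # cs) = (i, j) # path_edges (j # cs)"
| "path_edges cs = []"

lemma length_path_edges: "length (path_edges cs) = length cs - 1"
  by (induction cs rule: path_edges.induct) auto

lemma apply_transps_path_edges: "apply_transps (path_edges cs) = cycle_of_list cs"
  by (induction cs rule: path_edges.induct) simp_all

lemma path_edges_constant:
  assumes "\<And>a b. (a, b) \<in> set (path_edges cs) \<Longrightarrow> f a = f b" "x \<in> set cs"
  shows "f x = f (hd cs)"
  using assms
proof (induction cs arbitrary: x rule: path_edges.induct)
  case (1 i j cs)
  have "f i = f j"
    by (rule 1(2)) simp
  moreover have "f x = f (hd (j # cs))" if "x \<noteq> i"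
    by (rule 1(1), rule 1(2)) (use 1(3) that in simp_all)
  ultimately show ?case
    by (cases "x = i") simp_all
qed simp_all

lemma fst_path_edges: "(a, b) \<in> set (path_edges cs) \<Longrightarrow> a \<in> set cs"
  by (induction cs rule: path_edges.induct) auto

lemma apply_transps_concat_path_edges:
  "apply_transps (concat (map path_edges ds)) = product_of_cycles ds"
  by (induction ds) (simp_all only: list.map concat.simps apply_transps_Nil apply_transps_append
      product_of_cycles_simps apply_transps_path_edges)

text \<open>
  Think of \<open>f\<close> as labelling the points by their connected components in the graph with edges
  \<open>es\<close>. The number of cycles of the product in a component is expressed as the number of values of
  an arbitrary invariant function \<open>g\<close>, so that no orbits have to be handled; the last clause is the
  Riemann-Hurwitz inequality for each component.
\<close>

definition transposition_blocks :: "('a \<times> 'a) list \<Rightarrow> ('a \<Rightarrow> 'a) \<Rightarrow> bool" where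
  "transposition_blocks es f \<longleftrightarrow>
    (\<forall>(a, b)\<in>set es. f a = f b) \<and> (\<forall>x. f (apply_transps es x) = f x) \<and>
    (\<forall>v. finite {x. f x = v}) \<and>
    (\<forall>(g :: 'a \<Rightarrow> 'a) v. (\<forall>x. f x = v \<longrightarrow> g (apply_transps es x) = g x) \<longrightarrow>
      card {x. f x = v} + card (g ` {x. f x = v}) \<le> length (filter (\<lambda>e. f (fst e) = v) es) + 2)"

lemma transposition_blocksI:
  assumes "\<And>a b. (a, b) \<in> set es \<Longrightarrow> f a = f b" "\<And>x. f (apply_transps es x) = f x"
    and "\<And>v. finite {x. f x = v}"
    and bound: "\<And>(g :: 'a \<Rightarrow> 'a) v. (\<And>x. f x = v \<Longrightarrow> g (apply_transps es x) = g x) \<Longrightarrow>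
      card {x. f x = v} + card (g ` {x. f x = v}) \<le> length (filter (\<lambda>e. f (fst e) = v) es) + 2"
  shows "transposition_blocks es (f :: 'a \<Rightarrow> 'a)"
  unfolding transposition_blocks_def
proof (intro conjI allI impI)
  show "\<forall>(a, b)\<in>set es. f a = f b"
    using assms(1) by auto
  show "card {x. f x = v} + card (g ` {x. f x = v}) \<le> length (filter (\<lambda>e. f (fst e) = v) es) + 2"
    if "\<forall>x. f x = v \<longrightarrow> g (apply_transps es x) = g x" for g :: "'a \<Rightarrow> 'a" and v
    by (rule bound) (use that in blast)
qed (rule assms)+

lemma transposition_blocksD:
  assumes "transposition_blocks es (f :: 'a \<Rightarrow> 'a)"
  shows "(a, b) \<in> set es \<Longrightarrow> f a = f b" "f (apply_transps es x) = f x" "finite {x. f x = v}"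
    "(\<And>x. f x = v \<Longrightarrow> g (apply_transps es x) = (g x :: 'a)) \<Longrightarrow>
      card {x. f x = v} + card (g ` {x. f x = v}) \<le> length (filter (\<lambda>e. f (fst e) = v) es) + 2"
proof -
  note def = assms[unfolded transposition_blocks_def]
  show "(a, b) \<in> set es \<Longrightarrow> f a = f b"
    using conjunct1[OF def] by blast
  show "f (apply_transps es x) = f x"
    by (rule spec[OF conjunct1[OF conjunct2[OF def]]])
  show "finite {x. f x = v}"
    by (rule spec[OF conjunct1[OF conjunct2[OF conjunct2[OF def]]]])
  assume "\<And>x. f x = v \<Longrightarrow> g (apply_transps es x) = g x"
  then have "\<forall>x. f x = v \<longrightarrow> g (apply_transps es x) = g x"
    by blast
  then show "card {x. f x = v} + card (g ` {x. f x = v}) \<le> length (filter (\<lambda>e. f (fst e) = v) es) + 2"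
    by (rule mp[OF spec[OF spec[OF conjunct2[OF conjunct2[OF conjunct2[OF def]]]]]])
qed

text \<open>
  The transposition \<open>(a b)\<close> joins the cycle of \<open>\<pi>\<close> through \<open>a\<close> to
  the one through \<open>b\<close> if these points lie in different components, so an invariant function of the
  product agrees on them. Indeed, if the values differed, \<open>\<pi>\<close> would map the finite set of
  points of the component of \<open>a\<close> that share the value of \<open>a\<close> injectively into itself,
  and \<open>a\<close> would have no preimage, as a preimage would be sent to \<open>b\<close> by the product.
\<close>

lemma invariant_constant_across:
  fixes \<pi> :: "'a \<Rightarrow> 'a"
  assumes "inj \<pi>" "\<And>x. f (\<pi> x) = f x" "finite {x. f x = f a}" "f a \<noteq> f b"
    and "\<And>x. f x = f a \<Longrightarrow> g (transpose a b (\<pi> x)) = g x"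
  shows "g a = g b"
proof (rule ccontr)
  assume neq: "g a \<noteq> g b"
  let ?A = "{x. f x = f a \<and> g x = g a}"
  have step: "\<pi> x \<in> ?A" "\<pi> x \<noteq> a" if "x \<in> ?A" for x
  proof -
    have "\<pi> x \<noteq> b"
      using that assms(2)[of x] assms(4) by auto
    show "\<pi> x \<noteq> a"
      using assms(5)[of x] that neq by auto
    then show "\<pi> x \<in> ?A"
      using assms(2,5)[of x] that \<open>\<pi> x \<noteq> b\<close> by (auto simp: transpose_def)
  qed
  have "finite ?A"
    using assms(3) by (rule rev_finite_subset) auto
  moreover have "inj_on \<pi> ?A"
    using assms(1) by (rule inj_on_subset) simp
  ultimately have "\<pi> ` ?A = ?A"
    using step(1) by (intro endo_inj_surj) auto
  then have "a \<in> \<pi> ` ?A"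
    by simp
  then show False
    using step(2) by auto
qed

lemma length_filter_merge:
  "v \<noteq> w \<Longrightarrow> length (filter (\<lambda>e. h e = v \<or> h e = w) es)
    = length (filter (\<lambda>e. h e = v) es) + length (filter (\<lambda>e. h e = w) es)"
  by (induction es) auto

text \<open>
  A new transposition inside a component adds an edge and can split at most one cycle. A new transposition
  between two components merges them and merges two cycles, so points plus cycles drop by one; on the right-hand
  side one edge is gained and one of the two constants 2 is lost.
\<close>

theorem transposition_blocks_exist:
  "\<exists>f :: 'a \<Rightarrow> 'a. transposition_blocks es f"
proof (induction es)
  case Nil
  have "transposition_blocks [] id"
    by (rule transposition_blocksI) simp_all
  then show ?case by blast
next
  case (Cons e es)
  obtain f where f: "transposition_blocks es f"
    using Cons.IH by blast
  obtain a b where e: "e = (a, b)"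
    by (rule prod.exhaust)
  let ?\<pi> = "apply_transps es"
  have inj: "inj ?\<pi>"
    by (intro bij_is_inj permutation_bijective permutation_apply_transps)
  note const = transposition_blocksD(1)[OF f] and inv = transposition_blocksD(2)[OF f]
    and fin = transposition_blocksD(3)[OF f] and bound = transposition_blocksD(4)[OF f]
  have \<pi>': "apply_transps (e # es) x = transpose a b (?\<pi> x)" for x
    unfolding e by simp
  show ?case
  proof (cases "f a = f b")
    case True
    have f_transpose: "f (transpose a b x) = f x" for x
      using True by (simp add: transpose_def)
    have bound': "card {x. f x = v} + card (g ` {x. f x = v})
        \<le> length (filter (\<lambda>e. f (fst e) = v) (e # es)) + 2"
      if g: "\<And>x. f x = v \<Longrightarrow> g (apply_transps (e # es) x) = g x" for g :: "'a \<Rightarrow> 'a" and v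
    proof (cases "f a = v")
      case False
      have "g (?\<pi> x) = g x" if "f x = v" for x
      proof -
        have "?\<pi> x \<noteq> a" "?\<pi> x \<noteq> b"
          using that inv[of x] False True by auto
        then show ?thesis
          using g[OF that] unfolding \<pi>' by simp
      qed
      from bound[of v g, OF this] show ?thesis
        using False unfolding e by simp
    next
      case v: True
      \<comment> \<open>Identifying the values at \<open>a\<close> and \<open>b\<close> restores invariance at the cost of one value.\<close>
    let ?h = "\<lambda>x. if g x = g b then g a else g x"
      have h_transpose: "?h (transpose a b x) = ?h x" for x
        by (auto simp: transpose_def)
      have "?h (?\<pi> x) = ?h x" if "f x = v" for x
      proof -
        have "?h (?\<pi> x) = ?h (transpose a b (?\<pi> x))"
          by (rule h_transpose[symmetric])
        also have "\<dots> = ?h x"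
          using g[OF that] unfolding \<pi>' by simp
        finally show ?thesis .
      qed
      then have "card {x. f x = v} + card (?h ` {x. f x = v})
          \<le> length (filter (\<lambda>e. f (fst e) = v) es) + 2"
        by (rule bound)
      moreover have "card (g ` {x. f x = v}) \<le> card (insert (g b) (?h ` {x. f x = v}))"
        using fin[of v] by (intro card_mono) (auto simp: image_iff)
      moreover have "card (insert (g b) (?h ` {x. f x = v})) \<le> Suc (card (?h ` {x. f x = v}))"
        using fin[of v] by (simp add: card_insert_if)
      ultimately show ?thesis
        using v unfolding e by simp
    qed
    have inv': "f (apply_transps (e # es) x) = f x" for x
      unfolding \<pi>' f_transpose by (rule inv)
    have const': "f x = f y" if "(x, y) \<in> set (e # es)" for x y
      using that const True unfolding e by auto
    have "transposition_blocks (e # es) f"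
      by (rule transposition_blocksI, erule const', rule inv', rule fin, rule bound')
    then show ?thesis by blast
  next
    case False
    let ?f = "\<lambda>x. if f x = f b then f a else f x"
    have f_transpose: "?f (transpose a b x) = ?f x" for x
      by (auto simp: transpose_def)
    have block_a: "{x. ?f x = f a} = {x. f x = f a} \<union> {x. f x = f b}"
      using False by auto
    have block_b: "{x. ?f x = f b} = {}"
      using False by auto
    have block: "?f x = v \<longleftrightarrow> f x = v" if "v \<noteq> f a" "v \<noteq> f b" for v x
      using that by auto
    have bound': "card {x. ?f x = v} + card (g ` {x. ?f x = v})
        \<le> length (filter (\<lambda>e. ?f (fst e) = v) (e # es)) + 2"
      if g: "\<And>x. ?f x = v \<Longrightarrow> g (apply_transps (e # es) x) = g x" for g :: "'a \<Rightarrow> 'a" and v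
    proof -
      consider "v = f b" | "v \<noteq> f b" "v \<noteq> f a" | "v = f a"
        by blast
      then show ?thesis
      proof cases
        case 1
        then show ?thesis
          unfolding 1 block_b by simp
      next
        case 2
        have "g (?\<pi> x) = g x" if "f x = v" for x
        proof -
          have "?\<pi> x \<noteq> a" "?\<pi> x \<noteq> b"
            using that inv[of x] 2 by auto
          then show ?thesis
            using g[of x] that 2 unfolding \<pi>' by simp
        qed
        from bound[of v g, OF this] show ?thesis
          unfolding block[OF 2(2,1)] e using 2 by simp
      next
        case 3
        let ?A = "{x. f x = f a}" and ?B = "{x. f x = f b}"
        have g': "g (transpose a b (?\<pi> x)) = g x" if "f x = f a \<or> f x = f b" for x
          using g[of x] that unfolding \<pi>' 3 by auto
        have eq: "g a = g b"
          by (rule invariant_constant_across[of ?\<pi> f]) (use inj inv fin False g' in auto)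
        then have g_transpose: "g (transpose a b x) = g x" for x
          by (simp add: transpose_def)
        have g_inv: "g (?\<pi> x) = g x" if "f x = f a \<or> f x = f b" for x
          using g'[OF that] unfolding g_transpose .
        have IH: "card ?A + card (g ` ?A) \<le> length (filter (\<lambda>e. f (fst e) = f a) es) + 2"
            "card ?B + card (g ` ?B) \<le> length (filter (\<lambda>e. f (fst e) = f b) es) + 2"
          by (rule bound, rule g_inv, erule disjI1) (rule bound, rule g_inv, erule disjI2)
        have "card (?A \<union> ?B) = card ?A + card ?B"
          using False by (intro card_Un_disjoint fin) auto
        moreover have "card (g ` ?A) + card (g ` ?B) = card (g ` (?A \<union> ?B)) + card (g ` ?A \<inter> g ` ?B)"
          unfolding image_Un by (intro card_Un_Int finite_imageI fin)
        moreover have "g a \<in> g ` ?A"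
          by (rule imageI) simp
        moreover have "g a \<in> g ` ?B"
          unfolding eq by (rule imageI) simp
        moreover have "finite (g ` ?A \<inter> g ` ?B)"
          by (intro finite_Int disjI1 finite_imageI fin)
        ultimately have "card (g ` ?A \<inter> g ` ?B) > 0"
            "card (?A \<union> ?B) + card (g ` (?A \<union> ?B)) + card (g ` ?A \<inter> g ` ?B)
              = card ?A + card ?B + card (g ` ?A) + card (g ` ?B)"
          by (simp_all only: card_gt_0_iff, blast)
        moreover have "filter (\<lambda>e. ?f (fst e) = f a) es
            = filter (\<lambda>e. f (fst e) = f a \<or> f (fst e) = f b) es"
          by (rule filter_cong) auto
        then have "length (filter (\<lambda>e. ?f (fst e) = f a) (e # es))
            = length (filter (\<lambda>e. f (fst e) = f a) es) + length (filter (\<lambda>e. f (fst e) = f b) es) + 1"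
          using length_filter_merge[OF False, of "\<lambda>e. f (fst e)" es] unfolding e by simp
        ultimately show ?thesis
          using IH unfolding 3 block_a by linarith
      qed
    qed
    have fin': "finite {x. ?f x = v}" for v
      by (rule finite_subset[of _ "{x. f x = v} \<union> {x. f x = f b}"]) (use fin in auto)
    have inv': "?f (apply_transps (e # es) x) = ?f x" for x
      unfolding \<pi>' f_transpose inv by (rule refl)
    have const': "?f x = ?f y" if "(x, y) \<in> set (e # es)" for x y
      using that const[of x y] unfolding e by auto
    have "transposition_blocks (e # es) ?f"
      by (rule transposition_blocksI, erule const', rule inv', rule fin', rule bound')
    then show ?thesis by blast
  qed
qed

text \<open>
  Every \<open>l\<close>-cycle and every cycle of the product lies in one component. The number of
  \<open>l\<close>-cycles in the component \<open>v\<close> is \<open>j v\<close>. If a component that meets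
  the support of the product contained a single \<open>l\<close>-cycle, the product would coincide with it
  there, so one of the cycles in \<open>css\<close> would contain its \<open>l\<close> points.
\<close>

theorem riemann_hurwitz_blocks:
  fixes css ds :: "'a list list"
  assumes css: "distinct (concat css)" "\<And>c. c \<in> set css \<Longrightarrow> 2 \<le> length c \<and> length c < l"
    and ds: "\<And>d. d \<in> set ds \<Longrightarrow> distinct d \<and> length d = l"
    and prod: "product_of_cycles css = product_of_cycles ds"
  obtains j :: "'a \<Rightarrow> nat" and f :: "'a \<Rightarrow> 'a" where
    "\<forall>V. finite V \<longrightarrow> sum j V \<le> length ds"
    "\<forall>c\<in>set css. 2 \<le> j (f (hd c))"
    "\<forall>v. (\<Sum>c\<in>{c\<in>set css. f (hd c) = v}. length c + 1) \<le> (l - 1) * j v + 2"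
proof -
  define es where "es = concat (map path_edges ds)"
  let ?\<pi> = "product_of_cycles css"
  have \<pi>: "apply_transps es = ?\<pi>"
    unfolding es_def prod by (rule apply_transps_concat_path_edges)
  obtain f :: "'a \<Rightarrow> 'a" where f: "transposition_blocks es f"
    using transposition_blocks_exist by blast
  note edges = transposition_blocksD(1)[OF f] and inv = transposition_blocksD(2)[OF f, unfolded \<pi>]
    and fin = transposition_blocksD(3)[OF f] and bound = transposition_blocksD(4)[OF f, unfolded \<pi>]
  define j where "j v = length (filter (\<lambda>d. f (hd d) = v) ds)" for v
  have d_const: "f x = f (hd d)" if "d \<in> set ds" "x \<in> set d" for d x
  proof (rule path_edges_constant[OF _ that(2)])
    show "f a = f b" if "(a, b) \<in> set (path_edges d)" for a b
      by (rule edges) (use that \<open>d \<in> set ds\<close> in \<open>force simp: es_def\<close>)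
  qed
  have "length (filter (\<lambda>e. f (fst e) = v) (concat (map path_edges ds')))
      = (l - 1) * length (filter (\<lambda>d. f (hd d) = v) ds')" if "set ds' \<subseteq> set ds" for v ds'
    using that
  proof (induction ds')
    case (Cons d ds')
    have "f (fst e) = f (hd d)" if "e \<in> set (path_edges d)" for e
      using d_const[of d "fst e"] fst_path_edges[of "fst e" "snd e" d] that Cons.prems by simp
    then have "filter (\<lambda>e. f (fst e) = v) (path_edges d) = (if f (hd d) = v then path_edges d else [])"
      by (auto simp: filter_id_conv filter_empty_conv)
    then show ?case
      using Cons ds[of d] by (simp add: length_path_edges)
  qed simp
  then have edge_count: "length (filter (\<lambda>e. f (fst e) = v) es) = (l - 1) * j v" for v
    unfolding es_def j_def by simp
  have nonempty: "[] \<notin> set css"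
    using css(2) by force
  have dist: "\<And>c. c \<in> set css \<Longrightarrow> distinct c"
      "\<And>c d x. c \<in> set css \<Longrightarrow> d \<in> set css \<Longrightarrow> x \<in> set c \<Longrightarrow> x \<in> set d \<Longrightarrow> c = d"
    using css(1) unfolding distinct_concat_iff by blast+
  have on_c: "?\<pi> x = cycle_of_list c x" if "c \<in> set css" "x \<in> set c" for c x
    by (rule product_of_cycles_on_cycle[OF css(1) that])
  have c_const: "f x = f (hd c)" if "c \<in> set css" "x \<in> set c" for c x
    by (rule cycle_invariant_constant[OF dist(1)[OF that(1)] _ that(2)])
      (use inv on_c[OF that(1)] in metis)

  show thesis
  proof (rule that[of j f]; intro allI ballI impI)
    show "sum j V \<le> length ds" if "finite V" for V
    proof -
      have "sum (\<lambda>v. length (filter (\<lambda>d. f (hd d) = v) ds')) V \<le> length ds'" for ds'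
      proof (induction ds')
        case (Cons d ds')
        have "(\<Sum>v\<in>V. length (filter (\<lambda>d. f (hd d) = v) (d # ds')))
            = (\<Sum>v\<in>V. (if f (hd d) = v then 1 else 0) + length (filter (\<lambda>d. f (hd d) = v) ds'))"
          by (rule sum.cong) auto
        also have "\<dots> \<le> 1 + length ds'"
          using Cons.IH that by (simp add: sum.distrib)
        finally show ?case by simp
      qed simp
      then show ?thesis
        unfolding j_def .
    qed
  next
    fix c
    assume c: "c \<in> set css"
    let ?v = "f (hd c)"
    have hd: "hd c \<in> set c"
      using c nonempty by (metis hd_in_set)
    have outside: "product_of_cycles ds' y = y"
      if "filter (\<lambda>d. f (hd d) = ?v) ds' = []" "set ds' \<subseteq> set ds" "f y = ?v" for ds' y
    proof (rule product_of_cycles_outside)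
      show "y \<notin> set (concat ds')"
        using that d_const by (fastforce simp: filter_empty_conv)
    qed
    have moved: "?\<pi> (hd c) \<noteq> hd c"
    proof -
      obtain x y cs where c': "c = x # y # cs"
        using css(2)[OF c] by (cases c; cases "tl c") auto
      have "map (cycle_of_list c) c = rotate1 c"
        using map_cycle_of_list dist(1)[OF c] by blast
      then have "cycle_of_list c x = y"
        unfolding c' by simp
      then show ?thesis
        using on_c[OF c hd] dist(1)[OF c] unfolding c' by auto
    qed
    show "2 \<le> j ?v"
    proof (rule ccontr)
      assume "\<not> 2 \<le> j ?v"
      then consider "filter (\<lambda>d. f (hd d) = ?v) ds = []" | d0 where "filter (\<lambda>d. f (hd d) = ?v) ds = [d0]"
        unfolding j_def by (cases "filter (\<lambda>d. f (hd d) = ?v) ds"; cases "tl (filter (\<lambda>d. f (hd d) = ?v) ds)") auto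
      then show False
      proof cases
        case 1
        then show False
          using outside[of ds "hd c"] moved prod by simp
      next
        case (2 d0)
        obtain us vs where us_vs: "ds = us @ d0 # vs" "\<forall>d\<in>set us. f (hd d) \<noteq> ?v"
            "f (hd d0) = ?v" "[] = filter (\<lambda>d. f (hd d) = ?v) vs"
          using filter_eq_ConsD[OF 2] by blast
        then have split: "ds = us @ d0 # vs" "f (hd d0) = ?v"
            "filter (\<lambda>d. f (hd d) = ?v) us = []" "filter (\<lambda>d. f (hd d) = ?v) vs = []"
          by (simp_all only: filter_empty_conv)
        have on_d0: "?\<pi> y = cycle_of_list d0 y" if "f y = ?v" for y
        proof -
          have "product_of_cycles vs y = y"
            by (rule outside[OF split(4) _ that]) (use split(1) in auto)
          moreover have "f (cycle_of_list d0 y) = ?v"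
            using that d_const[of d0 "cycle_of_list d0 y"] split(1,2) id_outside_supp[of y d0]
            by (cases "y \<in> set d0") simp_all
          then have "product_of_cycles us (cycle_of_list d0 y) = cycle_of_list d0 y"
            by (intro outside[OF split(3)]) (use split(1) in auto)
          ultimately show ?thesis
            unfolding prod split(1) by (simp add: product_of_cycles_append)
        qed
        have d0: "distinct d0" "length d0 = l" "d0 \<in> set ds"
          using ds[of d0] split(1) by auto
        have "hd c \<in> set d0"
          using moved on_d0[of "hd c"] id_outside_supp[of "hd c" d0] by auto
        have "(y \<in> set c) = (hd d0 \<in> set c)" if "y \<in> set d0" for y
        proof (rule cycle_invariant_constant[OF d0(1) _ that])
          fix x
          assume "x \<in> set d0"
          then have "f x = ?v"
            using d_const[OF d0(3), of x] split(2) by simp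
          then have step: "cycle_of_list d0 x = ?\<pi> x"
            using on_d0 by simp
          have "?\<pi> x \<in> set c' \<longleftrightarrow> x \<in> set c'" if "c' \<in> set css" "x \<in> set c'" for c'
            using that on_c[OF that] by simp
          moreover have "?\<pi> x = x" if "x \<notin> set (concat css)"
            using that by (rule product_of_cycles_outside)
          ultimately show "(cycle_of_list d0 x \<in> set c) = (x \<in> set c)"
            unfolding step using c dist(2) by (metis UN_E set_concat)
        qed
        then have "set d0 \<subseteq> set c"
          using \<open>hd c \<in> set d0\<close> hd by blast
        then have "card (set d0) \<le> card (set c)"
          by (intro card_mono) auto
        then show False
          using d0 css(2)[OF c] dist(1)[OF c] by (simp add: distinct_card)
      qed
    qed
  next
    fix v
    let ?A = "{c \<in> set css. f (hd c) = v}" and ?B = "{x. f x = v}"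
    define g where "g x = (if \<exists>c\<in>set css. x \<in> set c then hd (SOME c. c \<in> set css \<and> x \<in> set c) else x)" for x
    have g_c: "g x = hd c" if "c \<in> set css" "x \<in> set c" for c x
    proof -
      have "(SOME c. c \<in> set css \<and> x \<in> set c) = c"
        by (rule some_equality) (use that dist(2) in blast)+
      then show ?thesis
        unfolding g_def using that by auto
    qed
    have "g (?\<pi> x) = g x" for x
    proof (cases "\<exists>c\<in>set css. x \<in> set c")
      case True
      then obtain c where c: "c \<in> set css" "x \<in> set c" by blast
      then have "?\<pi> x \<in> set c"
        using on_c by simp
      then show ?thesis
        using g_c c by simp
    next
      case False
      then have "?\<pi> x = x"
        by (intro product_of_cycles_outside) auto
      then show ?thesis by simp
    qed
    then have "card ?B + card (g ` ?B) \<le> (l - 1) * j v + 2"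
      unfolding edge_count[symmetric] by (intro bound)
    moreover have "(\<Sum>c\<in>?A. length c) \<le> card ?B"
    proof -
      have "(\<Union>c\<in>?A. set c) \<subseteq> ?B"
        using c_const by blast
      then have "card (\<Union>c\<in>?A. set c) \<le> card ?B"
        by (rule card_mono[OF fin])
      moreover have "card (\<Union>c\<in>?A. set c) = (\<Sum>c\<in>?A. length c)"
        by (rule card_concat_Un_hd(1)[OF css(1) nonempty]) blast
      ultimately show ?thesis by simp
    qed
    moreover have "card ?A \<le> card (g ` ?B)"
    proof -
      have "hd ` ?A \<subseteq> g ` ?B"
      proof
        fix y
        assume "y \<in> hd ` ?A"
        then obtain c where c: "c \<in> set css" "f (hd c) = v" "y = hd c" by blast
        have "hd c \<in> set c"
          using c(1) nonempty by (metis hd_in_set)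
        then show "y \<in> g ` ?B"
          using g_c[OF c(1)] c by force
      qed
      then have "card (hd ` ?A) \<le> card (g ` ?B)"
        by (intro card_mono finite_imageI fin)
      moreover have "card (hd ` ?A) = card ?A"
        by (intro card_image card_concat_Un_hd(2)[OF css(1) nonempty]) auto
      ultimately show ?thesis by simp
    qed
    ultimately show "(\<Sum>c\<in>?A. length c + 1) \<le> (l - 1) * j v + 2"
      unfolding sum.distrib by simp
  qed
qed

text \<open>
  An estimate for the cycles in one component that is linear in \<open>j\<close> adds up over the components.
  The weights \<open>w\<close> allow the estimate to absorb the effect of rounding.
\<close>

lemma cycle_weight_sum_le:
  fixes css ds :: "'a list list" and w :: "'a list \<Rightarrow> nat"
  assumes css: "distinct (concat css)" "\<And>c. c \<in> set css \<Longrightarrow> 2 \<le> length c \<and> length c < l"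
    and ds: "\<And>d. d \<in> set ds \<Longrightarrow> distinct d \<and> length d = l"
    and prod: "product_of_cycles css = product_of_cycles ds"
    and w: "\<And>C j. C \<subseteq> set css \<Longrightarrow> 2 \<le> j \<Longrightarrow> (\<Sum>c\<in>C. length c + 1) \<le> (l - 1) * j + 2 \<Longrightarrow> sum w C \<le> B * j"
  shows "sum w (set css) \<le> B * length ds"
proof -
  obtain j :: "'a \<Rightarrow> nat" and f :: "'a \<Rightarrow> 'a" where
    "\<forall>V. finite V \<longrightarrow> sum j V \<le> length ds" "\<forall>c\<in>set css. 2 \<le> j (f (hd c))"
    "\<forall>v. (\<Sum>c\<in>{c\<in>set css. f (hd c) = v}. length c + 1) \<le> (l - 1) * j v + 2"
    by (rule riemann_hurwitz_blocks[OF css ds prod])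
  then have j: "\<And>V. finite V \<Longrightarrow> sum j V \<le> length ds" "\<And>c. c \<in> set css \<Longrightarrow> 2 \<le> j (f (hd c))"
    "\<And>v. (\<Sum>c\<in>{c\<in>set css. f (hd c) = v}. length c + 1) \<le> (l - 1) * j v + 2"
    by simp_all
  let ?V = "(\<lambda>c. f (hd c)) ` set css"
  have "sum w (set css) = (\<Sum>v\<in>?V. sum w {c \<in> set css. f (hd c) = v})"
    by (rule sum.image_gen) simp
  also have "\<dots> \<le> (\<Sum>v\<in>?V. B * j v)"
    by (intro sum_mono w j(3)) (use j(2) in auto)
  also have "\<dots> \<le> B * length ds"
    unfolding sum_distrib_left[symmetric] by (intro mult_left_mono j(1)) simp_all
  finally show ?thesis .
qed

section \<open>Even permutations with many transpositions\<close>

lemma cycle_products_iff: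
  "\<pi> \<in> cycle_products n l k \<longleftrightarrow> product_of_cycles_of_length k l {1..n} \<pi>"
proof
  assume "\<pi> \<in> cycle_products n l k"
  then obtain ps where ps: "\<pi> = foldr (\<circ>) ps id" "length ps = k" "set ps \<subseteq> cycles_of_length n l"
    unfolding cycle_products_def by blast
  have "\<exists>ds. length ds = length ps \<and> (\<forall>d\<in>set ds. distinct d \<and> length d = l \<and> set d \<subseteq> {1..n})
      \<and> map cycle_of_list ds = ps"
    using ps(3)
  proof (induction ps)
    case (Cons p ps)
    then obtain d ds where "p = cycle_of_list d" "distinct d" "length d = l" "set d \<subseteq> {1..n}"
        "length ds = length ps" "\<forall>d\<in>set ds. distinct d \<and> length d = l \<and> set d \<subseteq> {1..n}"
        "map cycle_of_list ds = ps"
      unfolding cycles_of_length_def by auto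
    then show ?case
      by (intro exI[of _ "d # ds"]) auto
  qed simp
  then show "product_of_cycles_of_length k l {1..n} \<pi>"
    using ps(1,2) unfolding product_of_cycles_of_length_def product_of_cycles_def by metis
next
  assume "product_of_cycles_of_length k l {1..n} \<pi>"
  then obtain ds where ds: "length ds = k"
      "\<forall>d\<in>set ds. distinct d \<and> length d = l \<and> set d \<subseteq> {1..n}" "\<pi> = product_of_cycles ds"
    unfolding product_of_cycles_of_length_def by blast
  then have "set (map cycle_of_list ds) \<subseteq> cycles_of_length n l"
    unfolding cycles_of_length_def by auto
  then show "\<pi> \<in> cycle_products n l k"
    using ds unfolding cycle_products_def product_of_cycles_def by (metis (mono_tags, lifting) length_map mem_Collect_eq)
qed

lemma cycle_products_subset_alt_group:
  assumes "l \<ge> 1" "even k \<or> odd l"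
  shows "cycle_products n l k \<subseteq> carrier (alt_group n)"
proof
  fix \<pi>
  assume "\<pi> \<in> cycle_products n l k"
  then obtain ds where ds: "length ds = k"
      "\<forall>d\<in>set ds. distinct d \<and> length d = l \<and> set d \<subseteq> {1..n}" "\<pi> = product_of_cycles ds"
    unfolding cycle_products_iff product_of_cycles_of_length_def by blast
  have "length (concat ds) = k * l"
    using ds(1,2) by (induction ds arbitrary: k) auto
  moreover have "[] \<notin> set ds"
    using ds(2) assms(1) by auto
  ultimately have "evenperm \<pi>"
    using evenperm_product_of_cycles[of ds] ds assms(2) by auto
  moreover have "\<pi> permutes {1..n}"
    unfolding ds(3) by (rule product_of_cycles_permutes) (use ds(2) in auto)
  ultimately show "\<pi> \<in> carrier (alt_group n)"
    by (simp add: alt_group_carrier)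
qed

text \<open>
  The value \<open>x = 0\<close> means that there is no additional cycle.
\<close>

definition transpositions_and_cycle :: "nat \<Rightarrow> nat \<Rightarrow> nat list list" where
  "transpositions_and_cycle a x =
    map (\<lambda>i. [2 * i + 1, 2 * i + 2]) [0..<a] @ (if x = 0 then [] else [[2 * a + 1..<2 * a + 1 + x]])"

lemma concat_transpositions_and_cycle:
  "concat (transpositions_and_cycle a x) = [1..<2 * a + 1 + x]"
proof -
  have "concat (map (\<lambda>i. [2 * i + 1, 2 * i + 2]) [0..<a]) = [1..<2 * a + 1]"
    by (induction a) simp_all
  moreover have "[1..<2 * a + 1 + x] = [1..<2 * a + 1] @ [2 * a + 1..<2 * a + 1 + x]"
    by (rule upt_add_eq_append) simp
  ultimately show ?thesis
    unfolding transpositions_and_cycle_def concat_append by (cases "x = 0") (simp_all del: upt_Suc)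
qed

text \<open>
  The number \<open>u\<close> is the weight of a transposition and \<open>v\<close> the weight of the additional
  cycle. Only one component contains the latter, so its contribution to the Riemann-Hurwitz inequality is
  counted there.
\<close>

lemma not_covered:
  assumes "x = 0 \<or> 3 \<le> x" "x < l" "2 < l" "2 * a + x \<le> n"
    and even: "even (3 * a + (if x = 0 then 0 else x + 1))"
    and w: "\<And>b j. 2 \<le> j \<Longrightarrow> 3 * b \<le> (l - 1) * j + 2 \<Longrightarrow> u * b \<le> B * j"
    and wx: "\<And>b j. x \<noteq> 0 \<Longrightarrow> 2 \<le> j \<Longrightarrow> 3 * b + x + 1 \<le> (l - 1) * j + 2 \<Longrightarrow> u * b + v \<le> B * j"
    and big: "B * k < u * a + (if x = 0 then 0 else v)"
  shows "cycle_products n l k \<noteq> carrier (alt_group n)"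
proof
  assume covered: "cycle_products n l k = carrier (alt_group n)"
  let ?css = "transpositions_and_cycle a x"
  let ?P = "(\<lambda>i. [2 * i + 1, 2 * i + 2]) ` {0..<a}"
  define X where "X = [2 * a + 1..<2 * a + 1 + x]"
  have set: "set ?css = ?P \<union> (if x = 0 then {} else {X})"
    unfolding transpositions_and_cycle_def X_def by auto
  have dist: "distinct (concat ?css)"
    unfolding concat_transpositions_and_cycle by simp
  have lenX: "length X = x"
    unfolding X_def length_upt by simp
  have lens: "2 \<le> length c \<and> length c < l" if "c \<in> set ?css" for c
    using that assms(1-3) lenX unfolding set by (auto split: if_splits)
  have "length (concat ?css) = 2 * a + x"
    unfolding concat_transpositions_and_cycle length_upt by simp
  moreover have "length ?css = a + (if x = 0 then 0 else 1)"
    unfolding transpositions_and_cycle_def by simp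
  ultimately have len: "length (concat ?css) = 2 * a + x" "length ?css = a + (if x = 0 then 0 else 1)"
    by blast+
  have X: "X \<notin> ?P" if "x \<noteq> 0"
  proof
    assume "X \<in> ?P"
    then have "length X = 2"
      by auto
    then show False
      unfolding lenX using assms(1) that by simp
  qed
  have P: "finite C" "(\<Sum>c\<in>C. length c + 1) = 3 * card C" "(\<Sum>c\<in>C. if length c = 2 then u else v) = u * card C"
    if "C \<subseteq> ?P" for C
  proof -
    show "finite C"
      using that finite_subset by blast
    have two: "length c = 2" if "c \<in> C" for c
      using that \<open>C \<subseteq> ?P\<close> by auto
    have "(\<Sum>c\<in>C. length c + 1) = (\<Sum>c\<in>C. 3)"
      by (rule sum.cong) (simp_all add: two)
    then show "(\<Sum>c\<in>C. length c + 1) = 3 * card C"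
      by simp
    have "(\<Sum>c\<in>C. if length c = 2 then u else v) = (\<Sum>c\<in>C. u)"
      by (rule sum.cong) (simp_all add: two)
    then show "(\<Sum>c\<in>C. if length c = 2 then u else v) = u * card C"
      by simp
  qed
  have insertX: "(\<Sum>c\<in>insert X C. length c + 1) = 3 * card C + x + 1"
      "(\<Sum>c\<in>insert X C. if length c = 2 then u else v) = u * card C + v"
    if "C \<subseteq> ?P" "x \<noteq> 0" for C
  proof -
    have notin: "X \<notin> C"
      using X that by blast
    have "x \<noteq> 2"
      using assms(1) that(2) by simp
    then show "(\<Sum>c\<in>insert X C. length c + 1) = 3 * card C + x + 1"
      "(\<Sum>c\<in>insert X C. if length c = 2 then u else v) = u * card C + v"
      unfolding sum.insert[OF P(1)[OF that(1)] notin] P(2,3)[OF that(1)] lenX by simp_all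
  qed
  have "evenperm (product_of_cycles ?css)"
  proof (subst evenperm_product_of_cycles)
    show "\<forall>c\<in>set ?css. distinct c"
      using dist by (simp add: distinct_concat_iff)
    show "[] \<notin> set ?css"
      using lens[of "[]"] by auto
    show "even (length (concat ?css) + length ?css)"
      unfolding len using even by (cases "x = 0") simp_all
  qed
  moreover have "product_of_cycles ?css permutes {1..n}"
    by (rule product_of_cycles_permutes)
      (use assms(4) in \<open>auto simp only: concat_transpositions_and_cycle set_upt atLeastLessThan_iff atLeastAtMost_iff\<close>)
  ultimately have "product_of_cycles ?css \<in> cycle_products n l k"
    unfolding covered alt_group_carrier by blast
  then obtain ds where ds: "length ds = k" "\<And>d. d \<in> set ds \<Longrightarrow> distinct d \<and> length d = l"
      "product_of_cycles ?css = product_of_cycles ds"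
    unfolding cycle_products_iff product_of_cycles_of_length_def by blast
  have "(\<Sum>c\<in>set ?css. if length c = 2 then u else v) \<le> B * length ds"
  proof (rule cycle_weight_sum_le[OF dist lens ds(2,3)])
    fix C j
    assume C: "C \<subseteq> set ?css" "2 \<le> j" "(\<Sum>c\<in>C. length c + 1) \<le> (l - 1) * j + 2"
    show "(\<Sum>c\<in>C. if length c = 2 then u else v) \<le> B * j"
    proof (cases "x \<noteq> 0 \<and> X \<in> C")
      case True
      then obtain D where D: "C = insert X D" "X \<notin> D"
        by (metis mk_disjoint_insert)
      then have "D \<subseteq> ?P"
        using C(1) True unfolding set by auto
      then show ?thesis
        using C(3) insertX[of D] wx[of j "card D"] C(2) True unfolding D(1) by simp
    next
      case False
      then have "C \<subseteq> ?P"
        using C(1) unfolding set by (auto split: if_splits)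
      then show ?thesis
        using C(3) P[of C] w[of j "card C"] C(2) by simp
    qed
  qed
  moreover have "card ?P = a"
    by (subst card_image) (auto simp: inj_on_def)
  then have "(\<Sum>c\<in>set ?css. if length c = 2 then u else v) = u * a + (if x = 0 then 0 else v)"
    using insertX(2)[of ?P] P(3)[of ?P] unfolding set by (cases "x = 0") simp_all
  ultimately show False
    using big ds(1) by simp
qed

text \<open>
  A component with \<open>j\<close> factors has room for \<open>q * j\<close> transpositions, or one fewer if
  it also contains a 3-cycle. Just above the critical degree, \<open>k * q\<close> transpositions and a
  3-cycle are too much; beyond that there is room for \<open>k * q + 2\<close> transpositions, which is the
  next even number.
\<close>

lemma not_covered_mod3_1:
  assumes "1 \<le> q" "even (k * q)" "2 * k * q + 2 < n"
  shows "cycle_products n (3 * q + 1) k \<noteq> carrier (alt_group n)"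
proof -
  have w: "1 * b \<le> q * j" if "3 * b \<le> (3 * q + 1 - 1) * j + 2" for b j
    using that by simp
  have wx: "1 * b + 1 \<le> q * j" if "3 * b + 3 + 1 \<le> (3 * q + 1 - 1) * j + 2" for b j
    using that by simp
  have n: "2 * (k * q) + 2 < n"
    using assms(3) by (simp only: mult.assoc)
  have qk: "q * k = k * q"
    by (rule mult.commute)
  show ?thesis
  proof (cases "n = 2 * (k * q) + 3")
    case True
    show ?thesis
      by (rule not_covered[where a = "k * q" and x = 3, OF _ _ _ _ _ w wx])
        (use assms(1,2) True in \<open>simp_all add: qk\<close>)
  next
    case False
    show ?thesis
      by (rule not_covered[where a = "k * q + 2" and x = 0 and v = 0, OF _ _ _ _ _ w])
        (use assms(1,2) n False in \<open>simp_all add: qk\<close>)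
  qed
qed

text \<open>
  A component with \<open>j\<close> factors has room for at most \<open>(6 * q + 3) * j / 6\<close>
  transpositions, which makes \<open>M / 2\<close> in total with \<open>M = k * (2 * q + 1)\<close>. A
  3-cycle uses up the room of one transposition and a 4-cycle that of \<open>4 / 3\<close>, both because
  \<open>j \<ge> 2\<close>. Which test permutation is even depends on \<open>M\<close> modulo 4, which is
  determined by \<open>k\<close> because \<open>M + k\<close> is divisible by 4.
\<close>

lemma not_covered_mod3_2:
  assumes "1 \<le> q" "2 \<le> k" "even (k * (3 * q + 1))"
    and "k * (2 * q + 1) + (if k mod 4 = 1 then 0 else 1) < n"
  shows "cycle_products n (3 * q + 2) k \<noteq> carrier (alt_group n)"
proof -
  have w: "6 * b \<le> (6 * q + 3) * j" if "2 \<le> j" "3 * b \<le> (3 * q + 2 - 1) * j + 2" for b j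
  proof -
    have "3 * b \<le> 3 * (q * j) + j + 2"
      using that(2) by (simp add: algebra_simps)
    moreover have "6 * b \<le> 6 * t + 3 * j" if "3 * b \<le> 3 * t + j + 2" for t
      using that \<open>2 \<le> j\<close> by presburger
    ultimately have "6 * b \<le> 6 * (q * j) + 3 * j"
      by blast
    then show ?thesis
      by (simp add: algebra_simps)
  qed
  have w3: "6 * b + 6 \<le> (6 * q + 3) * j" if "2 \<le> j" "3 * b + 3 + 1 \<le> (3 * q + 2 - 1) * j + 2" for b j
    using that by (simp add: algebra_simps)
  have w4: "6 * b + 8 \<le> (6 * q + 3) * j" if "2 \<le> j" "3 * b + 4 + 1 \<le> (3 * q + 2 - 1) * j + 2" for b j
    using that by (simp add: algebra_simps)
  define M where "M = k * (2 * q + 1)"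
  have B: "(6 * q + 3) * k = 3 * M"
    unfolding M_def by (simp add: algebra_simps)
  \<comment> \<open>\<open>M + k = 2 * (k * (q + 1))\<close>\<close>
  have "even (k * (q + 1))"
    using assms(3) by auto
  then obtain r where "k * (q + 1) = 2 * r"
    by blast
  then have "2 * (k * (q + 1)) = 4 * r"
    by simp
  then have "4 dvd 2 * (k * (q + 1))"
    by simp
  then have mod: "4 dvd M + k"
    unfolding M_def by (simp add: algebra_simps)
  have plain: ?thesis if "even a" "2 * a \<le> n" "3 * M < 6 * a" for a
    by (rule not_covered[where a = a and x = 0 and v = 0, OF _ _ _ _ _ w])
      (use assms that B in simp_all)
  have three: ?thesis if "even a" "2 * a + 3 \<le> n" "3 * M < 6 * a + 6" for a
    by (rule not_covered[where a = a and x = 3, OF _ _ _ _ _ w w3])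
      (use assms that B in simp_all)
  have four: ?thesis if "odd a" "2 * a + 4 \<le> n" "3 * M < 6 * a + 8" for a
    by (rule not_covered[where a = a and x = 4, OF _ _ _ _ _ w w4])
      (use assms that B in simp_all)
  have n: "M + (if k mod 4 = 1 then 0 else 1) < n"
    using assms(4) unfolding M_def .
  have "k mod 4 < 4"
    by simp
  then consider "k mod 4 = 0" | "k mod 4 = 1" | "k mod 4 = 2" | "k mod 4 = 3"
    by linarith
  then show ?thesis
  proof cases
    case 1
    then have "4 dvd M"
      using mod by presburger
    then obtain s where s: "M = 4 * s" ..
    have "M > 0"
      using assms(2) unfolding M_def by simp
    consider "n = M + 2" | "n = M + 3" | "n \<ge> M + 4"
      using n 1 by fastforce
    then show ?thesis
    proof cases
      case 1
      show ?thesis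
        by (rule four[of "2 * s - 1"]) (use 1 s \<open>M > 0\<close> in presburger)+
    next
      case 2
      show ?thesis
        by (rule three[of "2 * s"]) (use 2 s in simp_all)
    next
      case 3
      show ?thesis
        by (rule plain[of "2 * s + 2"]) (use 3 s in simp_all)
    qed
  next
    case 2
    then have "M mod 4 = 3"
      using mod by presburger
    then obtain s where s: "M = 4 * s + 3"
      by (metis mult_div_mod_eq)
    show ?thesis
      by (rule plain[of "2 * s + 2"]) (use n 2 s in simp_all)
  next
    case 3
    then have "M mod 4 = 2"
      using mod by presburger
    then obtain s where s: "M = 4 * s + 2"
      by (metis mult_div_mod_eq)
    show ?thesis
      by (rule plain[of "2 * s + 2"]) (use n 3 s in simp_all)
  next
    case 4
    then have "M mod 4 = 1"
      using mod by presburger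
    then obtain s where s: "M = 4 * s + 1"
      by (metis mult_div_mod_eq)
    show ?thesis
    proof (cases "n = M + 2")
      case True
      show ?thesis
        by (rule three[of "2 * s"]) (use True s in simp_all)
    next
      case False
      show ?thesis
        by (rule plain[of "2 * s + 2"]) (use n 4 False s in simp_all)
    qed
  qed
qed

section \<open>The largest covered degree\<close>

lemma coveredI:
  assumes "l \<ge> 1" "even k \<or> odd l"
    and "\<And>css. distinct (concat css) \<Longrightarrow> \<forall>c\<in>set css. 2 \<le> length c \<Longrightarrow> set (concat css) \<subseteq> {1..n} \<Longrightarrow>
      even (length (concat css) + length css) \<Longrightarrow>
      product_of_cycles_of_length k l {1..n} (product_of_cycles css)"
  shows "cycle_products n l k = carrier (alt_group n)"
proof (rule antisym)
  show "cycle_products n l k \<subseteq> carrier (alt_group n)"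
    by (rule cycle_products_subset_alt_group[OF assms(1,2)])
  show "carrier (alt_group n) \<subseteq> cycle_products n l k"
  proof
    fix \<pi>
    assume "\<pi> \<in> carrier (alt_group n)"
    then have \<pi>: "\<pi> permutes {1..n}" "evenperm \<pi>"
      by (simp_all add: alt_group_carrier)
    obtain css where css: "distinct (concat css)" "\<forall>c\<in>set css. 2 \<le> length c"
        "set (concat css) \<subseteq> {1..n}" "\<pi> = product_of_cycles css"
      by (rule permutes_eq_product_of_cycles[OF \<pi>(1) finite_atLeastAtMost])
    have "\<forall>c\<in>set css. distinct c" "[] \<notin> set css"
      using css(1,2) by (auto simp: distinct_concat_iff)
    then have "even (length (concat css) + length css)"
      using evenperm_product_of_cycles \<pi>(2) css(4) by blast
    then show "\<pi> \<in> cycle_products n l k"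
      unfolding cycle_products_iff css(4) using css(1-3) by (intro assms(3))
  qed
qed

lemma largest_covered_degreeI:
  assumes "l \<le> n" "cycle_products n l k = carrier (alt_group n)"
    and "\<And>n'. n < n' \<Longrightarrow> cycle_products n' l k \<noteq> carrier (alt_group n')"
  shows "finite (covered_degrees k l) \<and> covered_degrees k l \<noteq> {} \<and> largest_covered_degree k l = n"
proof -
  have mem: "n \<in> covered_degrees k l"
    using assms(1,2) unfolding covered_degrees_def by blast
  have le: "n' \<le> n" if "n' \<in> covered_degrees k l" for n'
  proof (rule ccontr)
    assume "\<not> n' \<le> n"
    then have "cycle_products n' l k \<noteq> carrier (alt_group n')"
      by (intro assms(3)) simp
    then show False
      using that unfolding covered_degrees_def by simp
  qed
  have "covered_degrees k l \<subseteq> {..n}"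
    using le by blast
  then have fin: "finite (covered_degrees k l)"
    by (rule finite_subset) simp
  have "largest_covered_degree k l = n"
    unfolding largest_covered_degree_def by (rule Max_eqI[OF fin le mem])
  then show ?thesis
    using fin mem by blast
qed

theorem theoremA:
  fixes k l :: nat
  assumes "k \<ge> 2" and "l > 3" and "\<not> 3 dvd l" and "even k \<or> odd l"
  shows "finite (covered_degrees k l) \<and> covered_degrees k l \<noteq> {} \<and>
    real (largest_covered_degree k l) =
      (if l mod 3 = 1 then 2 * real k * (real l - 1) / 3 + 2
       else if k mod 4 \<noteq> 1 then real k * (2 * real l - 1) / 3 + 1
       else real k * (2 * real l - 1) / 3)"
proof -
  define q where "q = l div 3"
  have q: "1 \<le> q"
    using assms(2) unfolding q_def by simp
  have l: "l = 3 * q + l mod 3"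
    unfolding q_def by simp
  have "l mod 3 = 1 \<or> l mod 3 = 2"
    using assms(3) by presburger
  then consider "l = 3 * q + 1" "l mod 3 = 1" | "l = 3 * q + 2" "l mod 3 = 2"
    using l by metis
  then show ?thesis
  proof cases
    case 1
    have even: "even (k * q)"
      using assms(4) 1(1) by auto
    have "finite (covered_degrees k l) \<and> covered_degrees k l \<noteq> {} \<and>
        largest_covered_degree k l = 2 * k * q + 2"
    proof (rule largest_covered_degreeI)
      have "2 * q \<le> k * q"
        using assms(1) by simp
      then show "l \<le> 2 * k * q + 2"
        unfolding 1(1) mult.assoc using q by linarith
      show "cycle_products (2 * k * q + 2) l k = carrier (alt_group (2 * k * q + 2))"
      proof (rule coveredI)
        show "1 \<le> l"
          using assms(2) by simp
        have card: "card {1..2 * k * q + 2} = 2 * k * q + 2"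
          by simp
        show "product_of_cycles_of_length k l {1..2 * k * q + 2} (product_of_cycles css)"
          if "distinct (concat css)" "\<forall>c\<in>set css. 2 \<le> length c"
            "set (concat css) \<subseteq> {1..2 * k * q + 2}" "even (length (concat css) + length css)" for css
          unfolding 1(1) using finite_atLeastAtMost card q assms(1) even that
          by (rule product_of_cycles_of_length_mod3_1)
      qed (rule assms(4))
    qed (use not_covered_mod3_1[OF q even] 1(1) in blast)
    then show ?thesis
      using 1 by simp
  next
    case 2
    have even: "even (k * (3 * q + 1))"
      using assms(4) 2(1) by auto
    let ?n = "k * (2 * q + 1) + (if k mod 4 = 1 then 0 else 1)"
    have "finite (covered_degrees k l) \<and> covered_degrees k l \<noteq> {} \<and>
        largest_covered_degree k l = ?n"
    proof (rule largest_covered_degreeI)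
      have "2 * (2 * q + 1) \<le> k * (2 * q + 1)"
        by (rule mult_right_mono[OF assms(1)]) simp
      moreover have "3 * q + 2 \<le> 2 * (2 * q + 1)"
        by simp
      ultimately show "l \<le> ?n"
        unfolding 2(1) by (meson order_trans trans_le_add1)
      show "cycle_products ?n l k = carrier (alt_group ?n)"
      proof (rule coveredI)
        show "1 \<le> l"
          using assms(2) by simp
        have card: "card {1..?n} = ?n"
          by simp
        show "product_of_cycles_of_length k l {1..?n} (product_of_cycles css)"
          if "distinct (concat css)" "\<forall>c\<in>set css. 2 \<le> length c"
            "set (concat css) \<subseteq> {1..?n}" "even (length (concat css) + length css)" for css
          unfolding 2(1) using q assms(1) even finite_atLeastAtMost card that
          by (rule product_of_cycles_of_length_mod3_2)
      qed (rule assms(4))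
    qed (use not_covered_mod3_2[OF q assms(1) even] 2(1) in blast)
    moreover have "real l = 3 * real q + 2"
      unfolding 2(1) by simp
    ultimately show ?thesis
      using 2 by (simp add: field_simps)
  qed
qed

end
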